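(* Let $n,r$ be positive integers. For every multipartition $\lambda=(\lambda_1,\dots,\lambda_r)\in P(n,r)$, the determinant character of the irreducible representation $\rho_\lambda$ of $G(n,r)$ is $$\det\rho_\lambda=\zeta^{x_\lambda}\,\mathrm{sgn}^{y_\lambda}.$$
   Context: $G(n,r)=\mathbb{Z}_r^n\rtimes S_n$, where $\mathbb{Z}_r=\mathbb{Z}/r\mathbb{Z}$ and $S_n$ permutes coordinates; $G(0,r)$ is trivial. $P(n,r)$ is the set of $r$-tuples $\lambda=(\lambda_1,\dots,\lambda_r)$ of partitions (possibly empty) with $\sum_k|\lambda_k|=n$; write $a_k=|\lambda_k|$. Fix a primitive $r$-th root of unity $\zeta\in\mathbb{C}$; the same symbol denotes the character $\zeta(x;w)=\zeta^{x_1+\dots+x_n}$ of $G(n,r)$ ($x\in\mathbb{Z}_r^n$, $w\in S_n$), and $\mathrm{sgn}(x;w)$ is the sign of $w$. $\det\rho$ denotes the composition of $\rho$ with the determinant map. For a partition $\mu$ of $m$, let $\rho_\mu$ be the corresponding irreducible complex representation of $S_m$, $\chi_\mu$ its character, $f_\mu$ its dimension, and $\rho_\mu^k(x;w)=\zeta^{k(x_1+\dots+x_m)}\rho_\mu(w)$ its extension to $G(m,r)$, $0\le k\le r-1$. Define $$\rho_\lambda=\mathrm{Ind}_{G(a_1,r)\times\dots\times G(a_r,r)}^{G(n,r)}\ \rho_{\lambda_1}^{0}\boxtimes\rho_{\lambda_2}^{1}\boxtimes\dots\boxtimes\rho_{\lambda_r}^{r-1}.$$ For a partition $\mu$ of $m\ge2$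 put $g_\mu=\frac{f_\mu-\chi_\mu(s_1)}{2}$ with $s_1=(1\,2)$; for $m<2$ put $g_\mu=0$. Put $\widehat f_{\lambda_k}=\prod_{j\ne k}f_{\lambda_j}$. A multinomial coefficient with a negative lower entry is $0$. Define $$x_\lambda=f_{\lambda_1}\cdots f_{\lambda_r}\sum_{k=1}^{r-1}k\binom{n-1}{a_1,\dots,a_{k+1}-1,\dots,a_r}\in\mathbb{Z}/r\mathbb{Z},$$ and, for $n\ge2$, $$y_\lambda=f_{\lambda_1}\cdots f_{\lambda_r}\frac{(n-2)!}{a_1!\cdots a_r!}\sum_{1\le i<j\le r}a_ia_j+\sum_{k=1}^r g_{\lambda_k}\widehat f_{\lambda_k}\binom{n-2}{a_1,\dots,a_k-2,\dots,a_r}\in\mathbb{Z}/2\mathbb{Z}.$$ For $n=1$ (where $\mathrm{sgn}$ is trivial) put $y_\lambda=0$. *)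

theory Defs
  imports
    "HOL-Library.Function_Algebras"
    "HOL-Algebra.Elementary_Groups"
    "HOL-Algebra.Product_Groups"
    "HOL-Algebra.Sym_Groups"
    "Jordan_Normal_Form.Determinant"
begin

section \<open>Linear algebra in spaces of complex-valued functions\<close>

text \<open>All representation spaces below are finite-dimensional linear subspaces of some
  \<open>'x \<Rightarrow> complex\<close>.\<close>

definition cscale :: "complex \<Rightarrow> ('x \<Rightarrow> complex) \<Rightarrow> 'x \<Rightarrow> complex" where
  "cscale c f = (\<lambda>x. c * f x)"

global_interpretation cfun: vector_space "cscale :: complex \<Rightarrow> ('x \<Rightarrow> complex) \<Rightarrow> 'x \<Rightarrow> complex"
  by unfold_locales (auto simp: cscale_def fun_eq_iff algebra_simps)

definition ordered_basis :: "('x \<Rightarrow> complex) set \<Rightarrow> ('x \<Rightarrow> complex) list \<Rightarrow> bool" where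
  "ordered_basis V bs \<longleftrightarrow> distinct bs \<and> cfun.independent (set bs) \<and> cfun.span (set bs) = V"

definition matrix_on :: "('x \<Rightarrow> complex) list \<Rightarrow> (('x \<Rightarrow> complex) \<Rightarrow> ('x \<Rightarrow> complex)) \<Rightarrow> complex mat" where
  "matrix_on bs T = mat (length bs) (length bs)
     (\<lambda>(i, j). cfun.representation (set bs) (T (bs ! j)) (bs ! i))"

text \<open>Determinant and trace of an endomorphism \<open>T\<close> of a finite-dimensional \<open>V\<close>; the choice
  of basis is immaterial.\<close>

definition det_on :: "('x \<Rightarrow> complex) set \<Rightarrow> (('x \<Rightarrow> complex) \<Rightarrow> ('x \<Rightarrow> complex)) \<Rightarrow> complex" where
  "det_on V T = det (matrix_on (SOME bs. ordered_basis V bs) T)"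

definition trace_on :: "('x \<Rightarrow> complex) set \<Rightarrow> (('x \<Rightarrow> complex) \<Rightarrow> ('x \<Rightarrow> complex)) \<Rightarrow> complex" where
  "trace_on V T =
     (let M = matrix_on (SOME bs. ordered_basis V bs) T in \<Sum>i<dim_row M. M $$ (i, i))"


section \<open>Representations, external tensor products, induction\<close>

record ('g, 'x) rep =
  rep_space :: "('x \<Rightarrow> complex) set"
  rep_act :: "'g \<Rightarrow> ('x \<Rightarrow> complex) \<Rightarrow> ('x \<Rightarrow> complex)"

definition rep_dim :: "('g, 'x) rep \<Rightarrow> nat" where
  "rep_dim \<rho> = cfun.dim (rep_space \<rho>)"

definition rep_char :: "('g, 'x) rep \<Rightarrow> 'g \<Rightarrow> complex" where
  "rep_char \<rho> g = trace_on (rep_space \<rho>) (rep_act \<rho> g)"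

definition rep_det :: "('g, 'x) rep \<Rightarrow> 'g \<Rightarrow> complex" where
  "rep_det \<rho> g = det_on (rep_space \<rho>) (rep_act \<rho> g)"

text \<open>The tensor product over \<open>k \<in> K\<close> of subspaces \<open>V k\<close> of \<open>'x \<Rightarrow> complex\<close> is realised
  inside the functions on the \<open>K\<close>-fold power of \<open>'x\<close> (extensional functions on \<open>K\<close>), a pure
  tensor being the function \<open>x \<mapsto> \<Prod>k\<in>K. v k (x k)\<close>.\<close>

definition pure_tensor :: "'k set \<Rightarrow> ('k \<Rightarrow> 'x \<Rightarrow> complex) \<Rightarrow> ('k \<Rightarrow> 'x) \<Rightarrow> complex" where
  "pure_tensor K v = (\<lambda>x. if x \<in> extensional K then \<Prod>k\<in>K. v k (x k) else 0)"

definition tensor_space :: "'k set \<Rightarrow> ('k \<Rightarrow> ('x \<Rightarrow> complex) set) \<Rightarrow> (('k \<Rightarrow> 'x) \<Rightarrow> complex) set" where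
  "tensor_space K V = cfun.span {pure_tensor K v | v. \<forall>k\<in>K. v k \<in> V k}"

text \<open>The tensor product of operators \<open>A k\<close> on \<open>V k\<close>: the defining property determines it on
  \<open>tensor_space K V\<close>.\<close>

definition tensor_map ::
  "'k set \<Rightarrow> ('k \<Rightarrow> ('x \<Rightarrow> complex) set) \<Rightarrow> ('k \<Rightarrow> ('x \<Rightarrow> complex) \<Rightarrow> ('x \<Rightarrow> complex))
    \<Rightarrow> (('k \<Rightarrow> 'x) \<Rightarrow> complex) \<Rightarrow> (('k \<Rightarrow> 'x) \<Rightarrow> complex)" where
  "tensor_map K V A = (SOME L. Vector_Spaces.linear cscale cscale L \<and>
     (\<forall>v. (\<forall>k\<in>K. v k \<in> V k) \<longrightarrow> L (pure_tensor K v) = pure_tensor K (\<lambda>k. A k (v k))))"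

definition outer_tensor :: "'k set \<Rightarrow> ('k \<Rightarrow> ('g, 'x) rep) \<Rightarrow> ('k \<Rightarrow> 'g, 'k \<Rightarrow> 'x) rep" where
  "outer_tensor K \<rho> =
     \<lparr>rep_space = tensor_space K (\<lambda>k. rep_space (\<rho> k)),
      rep_act = (\<lambda>h. tensor_map K (\<lambda>k. rep_space (\<rho> k)) (\<lambda>k. rep_act (\<rho> k) (h k)))\<rparr>"

text \<open>\<open>Ind\<^sub>H\<^sup>G \<sigma>\<close> as the space of functions \<open>F\<close> from \<open>G\<close> to the space of \<open>\<sigma>\<close> with
  \<open>F (u h) = \<sigma>(h)\<^sup>-\<^sup>1 (F u)\<close> for \<open>h \<in> H\<close>, on which \<open>g\<close> acts by \<open>(g F) u = F (g\<^sup>-\<^sup>1 u)\<close>.  The functions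
  \<open>F\<close> are uncurried and extended by zero outside the carrier.\<close>

definition induced_rep ::
  "('g, 'm) monoid_scheme \<Rightarrow> 'g set \<Rightarrow> ('g, 'x) rep \<Rightarrow> ('g, 'g \<times> 'x) rep" where
  "induced_rep G H \<sigma> =
     \<lparr>rep_space = {F. (\<forall>u. u \<notin> carrier G \<longrightarrow> (\<forall>x. F (u, x) = 0)) \<and>
        (\<forall>u\<in>carrier G. (\<lambda>x. F (u, x)) \<in> rep_space \<sigma>) \<and>
        (\<forall>u\<in>carrier G. \<forall>h\<in>H.
           (\<lambda>x. F (u \<otimes>\<^bsub>G\<^esub> h, x)) = rep_act \<sigma> (inv\<^bsub>G\<^esub> h) (\<lambda>x. F (u, x)))},
      rep_act = (\<lambda>g F (u, x). if u \<in> carrier G then F (inv\<^bsub>G\<^esub> g \<otimes>\<^bsub>G\<^esub> u, x) else 0)\<rparr>"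


section \<open>The groups \<open>G(n,r)\<close>\<close>

type_synonym wreath_elt = "(nat \<Rightarrow> int) \<times> (nat \<Rightarrow> nat)"

text \<open>A permutation \<open>w\<close> sends \<open>(x\<^sub>1, \<dots>, x\<^sub>n)\<close> to the vector with \<open>i\<close>-th coordinate
  \<open>x (w\<^sup>-\<^sup>1 i)\<close>.\<close>

definition wreath_group :: "nat \<Rightarrow> nat \<Rightarrow> wreath_elt monoid" where
  "wreath_group n r =
    (let Z = product_group {1..n} (\<lambda>_. integer_mod_group r); S = sym_group n in
     \<lparr>carrier = carrier Z \<times> carrier S,
      monoid.mult = (\<lambda>(x, w) (y, v). (x \<otimes>\<^bsub>Z\<^esub> (y \<circ> inv' w), w \<otimes>\<^bsub>S\<^esub> v)),
      one = (\<one>\<^bsub>Z\<^esub>, \<one>\<^bsub>S\<^esub>)\<rparr>)"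

definition zeta_char :: "complex \<Rightarrow> nat \<Rightarrow> wreath_elt \<Rightarrow> complex" where
  "zeta_char \<zeta> n = (\<lambda>(x, w). \<zeta> powi (\<Sum>i=1..n. x i))"

definition sgn_char :: "wreath_elt \<Rightarrow> complex" where
  "sgn_char = (\<lambda>(x, w). of_int (sign w))"


section \<open>Partitions and Specht modules\<close>

definition is_partition :: "nat list \<Rightarrow> bool" where
  "is_partition \<mu> \<longleftrightarrow> sorted_wrt (\<ge>) \<mu> \<and> 0 \<notin> set \<mu>"

definition multipartitions :: "nat \<Rightarrow> nat \<Rightarrow> nat list list set" where
  "multipartitions n r =
     {lam. length lam = r \<and> (\<forall>\<mu>\<in>set lam. is_partition \<mu>) \<and> sum_list (map sum_list lam) = n}"

definition cells :: "nat list \<Rightarrow> (nat \<times> nat) set" where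
  "cells \<mu> = {(i, j). i < length \<mu> \<and> j < \<mu> ! i}"

definition tableaux :: "nat list \<Rightarrow> (nat \<times> nat \<Rightarrow> nat) set" where
  "tableaux \<mu> = {t. bij_betw t (cells \<mu>) {1..sum_list \<mu>}}"

text \<open>The tabloid (row equivalence class) of \<open>t\<close>, encoded by the function sending each entry
  to the index of its row.\<close>

definition tabloid :: "nat list \<Rightarrow> (nat \<times> nat \<Rightarrow> nat) \<Rightarrow> nat \<Rightarrow> nat" where
  "tabloid \<mu> t = (\<lambda>v\<in>{1..sum_list \<mu>}. fst (inv_into (cells \<mu>) t v))"

definition column_stabilizer :: "nat list \<Rightarrow> (nat \<times> nat \<Rightarrow> nat) \<Rightarrow> (nat \<Rightarrow> nat) set" where
  "column_stabilizer \<mu> t = {\<sigma>. \<sigma> permutes {1..sum_list \<mu>} \<and>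
     (\<forall>c\<in>cells \<mu>. \<sigma> (t c) \<in> t ` {d \<in> cells \<mu>. snd d = snd c})}"

text \<open>The polytabloid \<open>\<Sum>\<sigma>. sgn \<sigma> {\<sigma> t}\<close>, as a function on tabloids.\<close>

definition polytabloid :: "nat list \<Rightarrow> (nat \<times> nat \<Rightarrow> nat) \<Rightarrow> (nat \<Rightarrow> nat) \<Rightarrow> complex" where
  "polytabloid \<mu> t = (\<lambda>T. \<Sum>\<sigma>\<in>column_stabilizer \<mu> t.
     if T = tabloid \<mu> (\<sigma> \<circ> t) then of_int (sign \<sigma>) else 0)"

text \<open>In the encoding by row indices \<open>w\<^sup>-\<^sup>1 {t}\<close> is \<open>{t} \<circ> w\<close>, so that the usual action
  \<open>(w f) T = f (w\<^sup>-\<^sup>1 T)\<close> becomes composition with \<open>w\<close>.\<close>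

definition specht :: "nat list \<Rightarrow> (nat \<Rightarrow> nat, nat \<Rightarrow> nat) rep" where
  "specht \<mu> = \<lparr>rep_space = cfun.span (polytabloid \<mu> ` tableaux \<mu>),
                rep_act = (\<lambda>w f T. f (T \<circ> w))\<rparr>"

definition twisted_specht :: "complex \<Rightarrow> nat \<Rightarrow> nat list \<Rightarrow> (wreath_elt, nat \<Rightarrow> nat) rep" where
  "twisted_specht \<zeta> k \<mu> =
     \<lparr>rep_space = rep_space (specht \<mu>),
      rep_act = (\<lambda>(x, w) f. cscale (\<zeta> powi (int k * (\<Sum>i=1..sum_list \<mu>. x i))) (rep_act (specht \<mu>) w f))\<rparr>"


section \<open>The representations \<open>\<rho>\<^sub>\<lambda>\<close>\<close>

text \<open>The parts of a multipartition \<open>lam\<close> are numbered from 0, so \<open>lam ! k\<close> is the partition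
  usually called \<open>\<lambda>\<^sub>k\<^sub>+\<^sub>1\<close>, the one carrying the twist by \<open>\<zeta>^k\<close>.\<close>

definition part_size :: "nat list list \<Rightarrow> nat \<Rightarrow> nat" where
  "part_size lam k = sum_list (lam ! k)"

definition block_offset :: "nat list list \<Rightarrow> nat \<Rightarrow> nat" where
  "block_offset lam k = (\<Sum>j<k. part_size lam j)"

definition block :: "nat list list \<Rightarrow> nat \<Rightarrow> nat set" where
  "block lam k = {block_offset lam k + 1 .. block_offset lam k + part_size lam k}"

text \<open>The product \<open>G(a\<^sub>1,r) \<times> \<dots> \<times> G(a\<^sub>r,r)\<close> as a subgroup of \<open>G(n,r)\<close> (acting on consecutive
  blocks of coordinates), and the projection to its \<open>k\<close>-th factor.\<close>

definition young_subgroup :: "nat \<Rightarrow> nat \<Rightarrow> nat list list \<Rightarrow> wreath_elt set" where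
  "young_subgroup n r lam =
     {(x, w) \<in> carrier (wreath_group n r). \<forall>k<r. w ` block lam k = block lam k}"

definition block_component :: "nat list list \<Rightarrow> wreath_elt \<Rightarrow> nat \<Rightarrow> wreath_elt" where
  "block_component lam = (\<lambda>(x, w) k.
     (\<lambda>i\<in>{1..part_size lam k}. x (block_offset lam k + i),
      \<lambda>i. if i \<in> {1..part_size lam k} then w (block_offset lam k + i) - block_offset lam k else i))"

definition block_rep ::
  "complex \<Rightarrow> nat \<Rightarrow> nat list list \<Rightarrow> (wreath_elt, nat \<Rightarrow> nat \<Rightarrow> nat) rep" where
  "block_rep \<zeta> r lam =
     (let \<tau> = outer_tensor {..<r} (\<lambda>k. twisted_specht \<zeta> k (lam ! k)) in
      \<lparr>rep_space = rep_space \<tau>, rep_act = (\<lambda>h. rep_act \<tau> (block_component lam h))\<rparr>)"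

definition rho_lambda ::
  "complex \<Rightarrow> nat \<Rightarrow> nat \<Rightarrow> nat list list \<Rightarrow> (wreath_elt, wreath_elt \<times> (nat \<Rightarrow> nat \<Rightarrow> nat)) rep" where
  "rho_lambda \<zeta> n r lam =
     induced_rep (wreath_group n r) (young_subgroup n r lam) (block_rep \<zeta> r lam)"


section \<open>The exponents\<close>

definition f_dim :: "nat list \<Rightarrow> nat" where
  "f_dim \<mu> = rep_dim (specht \<mu>)"

definition g_mult :: "nat list \<Rightarrow> complex" where
  "g_mult \<mu> = (if sum_list \<mu> < 2 then 0
     else (of_nat (f_dim \<mu>) - rep_char (specht \<mu>) (Transposition.transpose 1 2)) / 2)"

text \<open>Only used when the lower entries add up to \<open>N\<close>.\<close>

definition multinomial :: "nat \<Rightarrow> int list \<Rightarrow> nat" where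
  "multinomial N as =
     (if \<exists>a\<in>set as. a < 0 then 0 else fact N div (\<Prod>a\<leftarrow>as. fact (nat a)))"

text \<open>The multinomial coefficient with upper entry \<open>n - d\<close> whose lower entries are the sizes
  of the parts, the \<open>k\<close>-th one diminished by \<open>d\<close>.\<close>

definition reduced_multinomial :: "nat \<Rightarrow> nat list list \<Rightarrow> nat \<Rightarrow> nat \<Rightarrow> nat" where
  "reduced_multinomial n lam k d =
     (let as = map (int \<circ> sum_list) lam in multinomial (n - d) (as[k := as ! k - int d]))"

text \<open>An integer representing the class modulo \<open>r\<close>.\<close>

definition x_lambda :: "nat \<Rightarrow> nat \<Rightarrow> nat list list \<Rightarrow> nat" where
  "x_lambda n r lam =
     (\<Prod>k<r. f_dim (lam ! k)) * (\<Sum>k=1..r-1. k * reduced_multinomial n lam k 1)"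

text \<open>The complex number given by the formula; it is an integer, whose class modulo 2 is the
  exponent of the sign character.\<close>

definition y_lambda :: "nat \<Rightarrow> nat \<Rightarrow> nat list list \<Rightarrow> complex" where
  "y_lambda n r lam = (if n < 2 then 0 else
     (\<Prod>k<r. of_nat (f_dim (lam ! k))) * (fact (n - 2) / (\<Prod>k<r. fact (part_size lam k)))
       * (\<Sum>j<r. \<Sum>i<j. of_nat (part_size lam i) * of_nat (part_size lam j))
     + (\<Sum>k<r. g_mult (lam ! k) * (\<Prod>j\<in>{..<r} - {k}. of_nat (f_dim (lam ! j)))
         * of_nat (reduced_multinomial n lam k 2)))"


section \<open>Consistency of the definitions\<close>

lemma tensor_map_pure_tensor:
  assumes "Vector_Spaces.linear cscale cscale L"
    and "\<And>v. (\<And>k. k \<in> K \<Longrightarrow> v k \<in> V k) \<Longrightarrow> L (pure_tensor K v) = pure_tensor K (\<lambda>k. A k (v k))"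
    and "\<And>k. k \<in> K \<Longrightarrow> v k \<in> V k"
  shows "tensor_map K V A (pure_tensor K v) = pure_tensor K (\<lambda>k. A k (v k))"
proof -
  let ?P = "\<lambda>L. Vector_Spaces.linear cscale cscale L \<and>
     (\<forall>v. (\<forall>k\<in>K. v k \<in> V k) \<longrightarrow> L (pure_tensor K v) = pure_tensor K (\<lambda>k. A k (v k)))"
  have "?P L" using assms by blast
  then have "?P (tensor_map K V A)" unfolding tensor_map_def by (rule someI[where P = ?P])
  with assms(3) show ?thesis by blast
qed

lemma outer_tensor_twisted_specht:
  assumes "\<And>k. k < r \<Longrightarrow> v k \<in> rep_space (specht (lam ! k))"
  shows "rep_act (outer_tensor {..<r} (\<lambda>k. twisted_specht \<zeta> k (lam ! k))) h (pure_tensor {..<r} v)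
    = pure_tensor {..<r} (\<lambda>k. rep_act (twisted_specht \<zeta> k (lam ! k)) (h k) (v k))"
proof -
  define c where "c k = \<zeta> powi (int k * (\<Sum>i=1..sum_list (lam ! k). fst (h k) i))" for k
  define L :: "((nat \<Rightarrow> nat \<Rightarrow> nat) \<Rightarrow> complex) \<Rightarrow> (nat \<Rightarrow> nat \<Rightarrow> nat) \<Rightarrow> complex"
    where "L F = (\<lambda>x. if x \<in> extensional {..<r}
       then (\<Prod>k<r. c k) * F (\<lambda>k\<in>{..<r}. x k \<circ> snd (h k)) else 0)" for F
  have act: "rep_act (twisted_specht \<zeta> k (lam ! k)) (h k) f = (\<lambda>T. c k * f (T \<circ> snd (h k)))" for k f
    by (simp add: twisted_specht_def specht_def cscale_def c_def split: prod.split)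
  have lin: "Vector_Spaces.linear cscale cscale L"
    unfolding Vector_Spaces.linear_def module_hom_def module_hom_axioms_def
    by (auto simp: cfun.vector_space_axioms cfun.module_axioms L_def cscale_def fun_eq_iff algebra_simps)
  have pure: "L (pure_tensor {..<r} u)
      = pure_tensor {..<r} (\<lambda>k. rep_act (twisted_specht \<zeta> k (lam ! k)) (h k) (u k))" for u
    by (auto simp: L_def pure_tensor_def act fun_eq_iff prod.distrib)
  show ?thesis
    unfolding outer_tensor_def rep.simps
    by (rule tensor_map_pure_tensor[OF lin]) (use assms in \<open>auto simp: pure twisted_specht_def\<close>)
qed

lemma group_wreath_group: "group (wreath_group n r)"
proof -
  define Z where "Z = product_group {1..n} (\<lambda>_. integer_mod_group r)"
  define S where "S = sym_group n"
  interpret Z: group Z unfolding Z_def by simp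
  interpret S: group S unfolding S_def by (rule sym_group_is_group)
  have G: "wreath_group n r = \<lparr>carrier = carrier Z \<times> carrier S,
      monoid.mult = (\<lambda>(x, w) (y, v). (x \<otimes>\<^bsub>Z\<^esub> (y \<circ> inv' w), w \<otimes>\<^bsub>S\<^esub> v)),
      one = (\<one>\<^bsub>Z\<^esub>, \<one>\<^bsub>S\<^esub>)\<rparr>"
    unfolding wreath_group_def Let_def Z_def S_def by (rule refl)
  have perm: "w permutes {1..n} \<longleftrightarrow> w \<in> carrier S" for w by (simp add: S_def sym_group_def)
  have act: "y \<circ> inv' w \<in> carrier Z" if "y \<in> carrier Z" "w \<in> carrier S" for y w
  proof -
    have w: "inv' w permutes {1..n}" using that(2) perm permutes_inv by blast
    have i: "i \<in> {1..n} \<longleftrightarrow> inv' w i \<in> {1..n}" for i using permutes_in_image[OF w] by blast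
    have o: "inv' w i = i" if "i \<notin> {1..n}" for i using w that unfolding permutes_def by blast
    show ?thesis using that(1) i o
      unfolding Z_def carrier_product_group PiE_def extensional_def Pi_def o_def by auto
  qed
  have hom: "(x \<otimes>\<^bsub>Z\<^esub> y) \<circ> inv' w = (x \<circ> inv' w) \<otimes>\<^bsub>Z\<^esub> (y \<circ> inv' w)"
    if "w \<in> carrier S" for x y w
  proof -
    have w: "inv' w permutes {1..n}" using that perm permutes_inv by blast
    have i: "i \<in> {1..n} \<longleftrightarrow> inv' w i \<in> {1..n}" for i using permutes_in_image[OF w] by blast
    show ?thesis unfolding Z_def product_group_def by (simp add: fun_eq_iff restrict_def i[unfolded One_nat_def, symmetric] del: atLeastAtMost_iff)
  qed
  have comp: "inv' (w \<otimes>\<^bsub>S\<^esub> v) = inv' v \<circ> inv' w" if "w \<in> carrier S" "v \<in> carrier S" for w v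
    using that permutes_bij perm by (metis S_def o_inv_distrib sym_group_mult)
  have one: "\<one>\<^bsub>Z\<^esub> \<circ> inv' w = \<one>\<^bsub>Z\<^esub>" if "w \<in> carrier S" for w
  proof -
    have "\<one>\<^bsub>Z\<^esub> \<circ> inv' w = (\<one>\<^bsub>Z\<^esub> \<circ> inv' w) \<otimes>\<^bsub>Z\<^esub> (\<one>\<^bsub>Z\<^esub> \<circ> inv' w)"
      using hom[OF that, of "\<one>\<^bsub>Z\<^esub>" "\<one>\<^bsub>Z\<^esub>"] by simp
    then show ?thesis using act[OF Z.one_closed that] by (simp add: Z.r_cancel_one)
  qed
  show ?thesis
  proof (rule groupI)
    show "\<one>\<^bsub>wreath_group n r\<^esub> \<in> carrier (wreath_group n r)" by (simp add: G)
  next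
    fix a b assume "a \<in> carrier (wreath_group n r)" "b \<in> carrier (wreath_group n r)"
    then show "a \<otimes>\<^bsub>wreath_group n r\<^esub> b \<in> carrier (wreath_group n r)" by (auto simp: G act)
  next
    fix a b c assume "a \<in> carrier (wreath_group n r)" "b \<in> carrier (wreath_group n r)"
      "c \<in> carrier (wreath_group n r)"
    then show "a \<otimes>\<^bsub>wreath_group n r\<^esub> b \<otimes>\<^bsub>wreath_group n r\<^esub> c
      = a \<otimes>\<^bsub>wreath_group n r\<^esub> (b \<otimes>\<^bsub>wreath_group n r\<^esub> c)"
      by (auto simp: G hom comp act Z.m_assoc S.m_assoc o_assoc)
  next
    fix a assume a: "a \<in> carrier (wreath_group n r)"
    have "inv' (\<one>\<^bsub>S\<^esub>) = (id :: nat \<Rightarrow> nat)" by (simp add: S_def sym_group_one)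
    with a show "\<one>\<^bsub>wreath_group n r\<^esub> \<otimes>\<^bsub>wreath_group n r\<^esub> a = a" by (auto simp: G)
  next
    fix a assume "a \<in> carrier (wreath_group n r)"
    then obtain x w where a: "a = (x, w)" "x \<in> carrier Z" "w \<in> carrier S" by (auto simp: G)
    let ?v = "inv\<^bsub>S\<^esub> w"
    let ?b = "(inv\<^bsub>Z\<^esub> (x \<circ> inv' ?v), ?v)"
    have "?b \<in> carrier (wreath_group n r)" using a act by (simp add: G)
    moreover have "?b \<otimes>\<^bsub>wreath_group n r\<^esub> a = \<one>\<^bsub>wreath_group n r\<^esub>" using a act by (simp add: G)
    ultimately show "\<exists>b\<in>carrier (wreath_group n r). b \<otimes>\<^bsub>wreath_group n r\<^esub> a = \<one>\<^bsub>wreath_group n r\<^esub>"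
      by blast
  qed
qed

lemma specht_act_polytabloid:
  assumes "w permutes {1..sum_list \<mu>}" "t \<in> tableaux \<mu>"
  shows "w \<circ> t \<in> tableaux \<mu>"
    "rep_act (specht \<mu>) w (polytabloid \<mu> t) = polytabloid \<mu> (w \<circ> t)"
proof -
  show 1: "w \<circ> t \<in> tableaux \<mu>" using assms
    by (auto simp: tableaux_def intro: bij_betw_trans permutes_imp_bij)
  let ?A = "{1..sum_list \<mu>}"
  have tab: "tabloid \<mu> (w \<circ> s) \<circ> w = tabloid \<mu> s" if s: "s \<in> tableaux \<mu>" for s
  proof
    fix v
    have wv: "w v \<in> ?A \<longleftrightarrow> v \<in> ?A" using permutes_in_image[OF assms(1)] by blast
    have bij: "bij_betw s (cells \<mu>) ?A" using s by (simp only: tableaux_def mem_Collect_eq)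
    have inj: "inj_on s (cells \<mu>)" using bij by (rule bij_betw_imp_inj_on)
    show "(tabloid \<mu> (w \<circ> s) \<circ> w) v = tabloid \<mu> s v"
    proof (cases "v \<in> ?A")
      case True
      have "v \<in> s ` cells \<mu>" using True bij_betw_imp_surj_on[OF bij] by simp
      then obtain c where c: "c \<in> cells \<mu>" "s c = v" by (elim imageE) simp
      have "inj_on (w \<circ> s) (cells \<mu>)" using inj permutes_inj[OF assms(1)]
        by (meson comp_inj_on inj_on_subset subset_UNIV)
      then have "inv_into (cells \<mu>) (w \<circ> s) (w v) = c" using inv_into_f_f[of "w \<circ> s" "cells \<mu>" c] c by simp
      moreover have "inv_into (cells \<mu>) s v = c" using inv_into_f_f[OF inj c(1)] c by simp
      ultimately show ?thesis using True wv by (simp add: tabloid_def)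
    next
      case False
      then show ?thesis by (simp only: tabloid_def comp_apply restrict_apply wv if_False)
    qed
  qed
  have winj: "w a = w b \<longleftrightarrow> a = b" for a b using permutes_inj[OF assms(1)] by (simp add: inj_eq)
  have iw: "inv' w \<circ> w = id" "w \<circ> inv' w = id" using assms(1) by (simp_all add: permutes_inv_o)
  have C: "bij_betw (\<lambda>\<sigma>. w \<circ> \<sigma> \<circ> inv' w) (column_stabilizer \<mu> t) (column_stabilizer \<mu> (w \<circ> t))"
  proof (rule bij_betw_byWitness[where f' = "\<lambda>\<sigma>. inv' w \<circ> \<sigma> \<circ> w"])
    show "\<forall>\<sigma>\<in>column_stabilizer \<mu> t. inv' w \<circ> (w \<circ> \<sigma> \<circ> inv' w) \<circ> w = \<sigma>"
      using iw by (auto simp: fun_eq_iff)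
    show "\<forall>\<sigma>\<in>column_stabilizer \<mu> (w \<circ> t). w \<circ> (inv' w \<circ> \<sigma> \<circ> w) \<circ> inv' w = \<sigma>"
      using iw by (auto simp: fun_eq_iff)
    have a: "inv' w (w a) = a" "w (inv' w a) = a" for a using iw by (metis comp_apply id_apply)+
    have iwp: "inv' w permutes ?A" by (rule permutes_inv[OF assms(1)])
    show "(\<lambda>\<sigma>. w \<circ> \<sigma> \<circ> inv' w) ` column_stabilizer \<mu> t \<subseteq> column_stabilizer \<mu> (w \<circ> t)"
    proof (rule image_subsetI)
      fix \<sigma> assume "\<sigma> \<in> column_stabilizer \<mu> t"
      then have s: "\<sigma> permutes ?A" "\<And>c. c \<in> cells \<mu> \<Longrightarrow> \<sigma> (t c) \<in> t ` {d \<in> cells \<mu>. snd d = snd c}"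
        by (simp_all add: column_stabilizer_def)
      have "(w \<circ> \<sigma> \<circ> inv' w) ((w \<circ> t) c) \<in> (w \<circ> t) ` {d \<in> cells \<mu>. snd d = snd c}" if "c \<in> cells \<mu>" for c
        using s(2)[OF that] unfolding image_comp[symmetric] by (simp only: comp_apply a) (rule imageI)
      moreover have "w \<circ> \<sigma> \<circ> inv' w permutes ?A" by (intro permutes_compose s iwp assms(1))
      ultimately show "w \<circ> \<sigma> \<circ> inv' w \<in> column_stabilizer \<mu> (w \<circ> t)" unfolding column_stabilizer_def by blast
    qed
    show "(\<lambda>\<sigma>. inv' w \<circ> \<sigma> \<circ> w) ` column_stabilizer \<mu> (w \<circ> t) \<subseteq> column_stabilizer \<mu> t"
    proof (rule image_subsetI)
      fix \<sigma> assume "\<sigma> \<in> column_stabilizer \<mu> (w \<circ> t)"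
      then have s: "\<sigma> permutes ?A" "\<And>c. c \<in> cells \<mu> \<Longrightarrow> \<sigma> (w (t c)) \<in> w ` t ` {d \<in> cells \<mu>. snd d = snd c}"
        by (simp_all add: column_stabilizer_def image_comp)
      have "(inv' w \<circ> \<sigma> \<circ> w) (t c) \<in> t ` {d \<in> cells \<mu>. snd d = snd c}" if c: "c \<in> cells \<mu>" for c
      proof -
        obtain z where "z \<in> t ` {d \<in> cells \<mu>. snd d = snd c}" "\<sigma> (w (t c)) = w z"
          using s(2)[OF c] by (rule imageE) 
        then show ?thesis by (simp only: comp_apply a)
      qed
      moreover have "inv' w \<circ> \<sigma> \<circ> w permutes ?A" by (intro permutes_compose s iwp assms(1))
      ultimately show "inv' w \<circ> \<sigma> \<circ> w \<in> column_stabilizer \<mu> t" unfolding column_stabilizer_def by blast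
    qed
  qed
  show "rep_act (specht \<mu>) w (polytabloid \<mu> t) = polytabloid \<mu> (w \<circ> t)"
  proof
    fix T
    have "polytabloid \<mu> (w \<circ> t) T = (\<Sum>\<sigma>\<in>column_stabilizer \<mu> t.
        if T = tabloid \<mu> (w \<circ> \<sigma> \<circ> inv' w \<circ> (w \<circ> t)) then of_int (sign (w \<circ> \<sigma> \<circ> inv' w)) else 0)"
      unfolding polytabloid_def by (rule sum.reindex_bij_betw[OF C, symmetric])
    also have "\<dots> = (\<Sum>\<sigma>\<in>column_stabilizer \<mu> t.
        if T \<circ> w = tabloid \<mu> (\<sigma> \<circ> t) then of_int (sign \<sigma>) else 0)"
    proof (rule sum.cong[OF refl])
      fix \<sigma> assume "\<sigma> \<in> column_stabilizer \<mu> t"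
      then have s: "\<sigma> permutes ?A" by (simp add: column_stabilizer_def)
      then have st: "\<sigma> \<circ> t \<in> tableaux \<mu>" using assms(2)
        by (auto simp: tableaux_def intro: bij_betw_trans permutes_imp_bij)
      have p: "permutation \<sigma>" "permutation w" "permutation (inv' w)"
        using s assms(1) permutes_inv by (auto intro: permutation_permutes[THEN iffD2])
      have sg: "sign (w \<circ> \<sigma> \<circ> inv' w) = sign \<sigma>"
        using p by (simp add: sign_compose permutation_compose sign_inverse sign_idempotent mult.commute mult.left_commute)
      have e: "w \<circ> \<sigma> \<circ> inv' w \<circ> (w \<circ> t) = w \<circ> (\<sigma> \<circ> t)" using iw by (auto simp: fun_eq_iff)
      have "T = tabloid \<mu> (w \<circ> (\<sigma> \<circ> t)) \<longleftrightarrow> T \<circ> w = tabloid \<mu> (\<sigma> \<circ> t)"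
        unfolding tab[OF st, symmetric] using iw by (metis comp_assoc comp_id)
      then show "(if T = tabloid \<mu> (w \<circ> \<sigma> \<circ> inv' w \<circ> (w \<circ> t)) then of_int (sign (w \<circ> \<sigma> \<circ> inv' w)) else 0)
        = (if T \<circ> w = tabloid \<mu> (\<sigma> \<circ> t) then of_int (sign \<sigma>) else (0::complex))"
        by (simp add: e sg)
    qed
    finally show "rep_act (specht \<mu>) w (polytabloid \<mu> t) T = polytabloid \<mu> (w \<circ> t) T"
      by (simp add: specht_def polytabloid_def)
  qed
qed

end

theory Submission
  imports Defs "Jordan_Normal_Form.Schur_Decomposition"
begin

text \<open>\<open>G(n,r)\<close> is generated by \<open>\<int>\<^sub>r\<^sup>n\<close> and the transpositions, so it suffices to compute the determinant
  on these.  The cosets of the Young subgroup correspond to the colourings of the \<open>n\<close> coordinates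
  by \<open>r\<close> colours, colour \<open>k\<close> being used as often as the size of the \<open>k\<close>-th part.
  Elements of \<open>\<int>\<^sub>r\<^sup>n\<close> act by a scalar on the block of each coset, namely by
  \<open>\<zeta> powi (\<Sum>i. c i * x i)\<close> on that of the colouring \<open>c\<close>; counting the colourings with a prescribed
  value at \<open>i\<close> gives the exponent \<open>x\<^sub>\<lambda>\<close>.  A transposition \<open>s\<close> acts as an involution, and an
  involution of trace \<open>t\<close> on a space of dimension \<open>d\<close> has determinant \<open>(-1) ^ ((d - t) / 2)\<close>.
  The trace is given by the formula for induced characters, to which only the colourings with
  equal values at the two moved points contribute, and \<open>(d - t) / 2\<close> turns out to be equal to
  \<open>y\<^sub>\<lambda>\<close> as a number, not only modulo 2.\<close>

section \<open>Determinants and traces on function spaces\<close>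

text \<open>\<open>det_on\<close> and \<open>trace_on\<close> depend on a basis picked by
  \<open>SOME\<close>, \<open>tensor_map\<close> on a linear map picked by \<open>SOME\<close>.
  Bases dual to point evaluations remove the first choice up to similarity: they exist for spaces of
  functions supported on a common finite set and pass to tensor products and induced spaces. The
  second choice gives way to an explicit operator that agrees with it on the tensor space. The two
  summands of \<open>y_lambda\<close> count eigenvalues -1 of a transposition s. A colouring with
  different values at the two moved points lies in a pair of cosets swapped by s, and such a pair
  yields -1 once per dimension of the tensor product; the first summand is the number of these pairs
  times that dimension. A colouring with the common value k at both points gives a coset fixed by s,
  on which s acts as a transposition of the Specht module number k; there -1 has multiplicity
  \<open>g_mult\<close> times the dimensions of the other factors, which gives the second summand.
  Integrality of the complex number \<open>y_lambda\<close> is a by-product.\<close>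

definition mat_trace :: "complex mat \<Rightarrow> complex" where
  "mat_trace A = (\<Sum>i<dim_row A. A $$ (i, i))"

lemma mat_trace_comm:
  assumes "A \<in> carrier_mat n m" "B \<in> carrier_mat m n"
  shows "mat_trace (A * B) = mat_trace (B * A)"
proof -
  have "mat_trace (A * B) = (\<Sum>i<n. \<Sum>j<m. A $$ (i, j) * B $$ (j, i))"
    using assms by (auto simp: mat_trace_def scalar_prod_def atLeast0LessThan intro!: sum.cong)
  also have "\<dots> = (\<Sum>j<m. \<Sum>i<n. B $$ (j, i) * A $$ (i, j))"
    by (subst sum.swap) (simp add: mult.commute)
  also have "\<dots> = mat_trace (B * A)"
    using assms by (auto simp: mat_trace_def scalar_prod_def atLeast0LessThan intro!: sum.cong)
  finally show ?thesis .
qed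

lemma mat_trace_similar:
  assumes "similar_mat A B"
  shows "mat_trace A = mat_trace B"
proof -
  obtain n P Q where *: "{A, B, P, Q} \<subseteq> carrier_mat n n" "P * Q = 1\<^sub>m n" "Q * P = 1\<^sub>m n" "A = P * B * Q"
    using similar_matD[OF assms] by blast
  have "mat_trace A = mat_trace (Q * (P * B))"
    unfolding *(4) using * by (intro mat_trace_comm[of _ n n]) auto
  also have "Q * (P * B) = (Q * P) * B"
    by (rule assoc_mult_mat[symmetric, of _ n n _ n _ n]) (use * in auto)
  also have "\<dots> = B" using *(1) left_mult_one_mat[of B n n] by (simp add: *(3))
  finally show ?thesis .
qed

text \<open>\<open>m\<close> counts the indices with value -1: each of them flips the sign of the
  product and lowers the sum by 2 against \<open>n\<close>.\<close>

lemma sum_of_signs: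
  fixes c :: "nat \<Rightarrow> complex"
  assumes "\<And>i. i < n \<Longrightarrow> c i = 1 \<or> c i = -1"
  shows "\<exists>m. (\<Prod>i<n. c i) = (-1) ^ m \<and> of_nat n - (\<Sum>i<n. c i) = 2 * of_nat m"
  using assms
proof (induction n)
  case 0
  show ?case by (rule exI[of _ 0]) simp
next
  case (Suc n)
  obtain m where m: "(\<Prod>i<n. c i) = (-1) ^ m" "of_nat n - (\<Sum>i<n. c i) = 2 * of_nat m"
    using Suc by auto
  have m2: "(\<Sum>i<n. c i) = of_nat n - 2 * of_nat m" using m(2) by (simp add: algebra_simps)
  show ?case
  proof (cases "c n = 1")
    case True
    then show ?thesis using m m2 by (intro exI[of _ m]) simp
  next
    case False
    then have "c n = -1" using Suc.prems[of n] by simp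
    then show ?thesis using m m2 by (intro exI[of _ "Suc m"]) simp
  qed
qed

text \<open>A triangular matrix similar to \<open>M\<close> is again an involution, so its diagonal
  entries are 1 or -1; determinant and trace are then the product and the sum of these
  signs.\<close>

lemma det_involution:
  fixes M :: "complex mat"
  assumes M: "M \<in> carrier_mat n n" and inv: "M * M = 1\<^sub>m n"
  shows "\<exists>m. det M = (-1) ^ m \<and> of_nat n - mat_trace M = 2 * of_nat m"
proof -
  obtain as where "char_poly M = (\<Prod>a\<leftarrow>as. [:- a, 1:])" using char_poly_factorized[OF M] by blast
  then obtain B where B: "B \<in> carrier_mat n n" "upper_triangular B" "similar_mat M B"
    using schur_decomposition_exists[OF M] by blast
  obtain n' P Q where *: "{M, B, P, Q} \<subseteq> carrier_mat n' n'" "P * Q = 1\<^sub>m n'" "Q * P = 1\<^sub>m n'" "M = P * B * Q"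
    using similar_matD[OF B(3)] by blast
  have n': "n' = n" using * M by auto
  note * = *[unfolded n']
  have c: "P \<in> carrier_mat n n" "Q \<in> carrier_mat n n" using * by auto
  note assoc = assoc_mult_mat[of _ n n _ n _ n]
  have BQ: "B * Q \<in> carrier_mat n n" using B(1) c by simp
  have "Q * M = Q * (P * (B * Q))" unfolding *(4) using assoc[OF c(1) B(1) c(2)] by simp
  also have "\<dots> = (Q * P) * (B * Q)" by (rule assoc[OF c(2,1) BQ, symmetric])
  also have "\<dots> = B * Q" unfolding *(3) using BQ by (rule left_mult_one_mat)
  finally have QM: "Q * M = B * Q" .
  have B_eq: "B = Q * M * P"
    unfolding QM assoc[OF B(1) c(2,1)] *(3) using B(1) by simp
  have "B * B = (B * Q) * M * P"
  proof -
    have "B * B = B * (Q * M * P)" using B_eq by simp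
    also have "\<dots> = B * (Q * M) * P" using assoc[of B "Q * M" P] B(1) c M by simp
    also have "B * (Q * M) = B * Q * M" using assoc[of B Q M] B(1) c M by simp
    finally show ?thesis .
  qed
  also have "\<dots> = Q * (M * M) * P"
    unfolding QM[symmetric] using assoc[OF c(2) M M] by simp
  also have "\<dots> = 1\<^sub>m n" unfolding inv using c *(3) by simp
  finally have BB: "B * B = 1\<^sub>m n" .
  \<comment> \<open>In a diagonal entry of \<open>B * B\<close> a summand with \<open>k\<close>
    different from \<open>i\<close> contains one factor below the diagonal, so only the square of
    the diagonal entry survives.\<close>
  have diag: "B $$ (i, i) = 1 \<or> B $$ (i, i) = -1" if i: "i < n" for i
  proof -
    have "1 = (B * B) $$ (i, i)" using BB i by simp
    also have "\<dots> = (\<Sum>k<n. B $$ (i, k) * B $$ (k, i))"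
      using B(1) i by (simp add: scalar_prod_def atLeast0LessThan)
    also have "\<dots> = (\<Sum>k<n. if k = i then B $$ (i, i) * B $$ (i, i) else 0)"
    proof (rule sum.cong[OF refl])
      fix k assume "k \<in> {..<n}"
      then show "B $$ (i, k) * B $$ (k, i) = (if k = i then B $$ (i, i) * B $$ (i, i) else 0)"
        using upper_triangularD[OF B(2), of k i] upper_triangularD[OF B(2), of i k] B(1) i
        by (cases k i rule: linorder_cases) auto
    qed
    also have "\<dots> = B $$ (i, i) * B $$ (i, i)" using i by simp
    finally show ?thesis by (metis square_eq_1_iff)
  qed
  have "det M = (\<Prod>i<n. B $$ (i, i))"
    using det_similar[OF B(3)] det_upper_triangular[OF B(2,1)] B(1)
    by (simp add: prod_list_diag_prod atLeast0LessThan)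
  moreover have "mat_trace M = (\<Sum>i<n. B $$ (i, i))"
    using mat_trace_similar[OF B(3)] B(1) by (simp add: mat_trace_def)
  ultimately show ?thesis using sum_of_signs[of n "\<lambda>i. B $$ (i, i)"] diag by auto
qed

text \<open>A basis of \<open>V\<close> dual to the evaluations at the points of \<open>X\<close>.  With respect to it the matrix
  entries of \<open>T\<close> are values \<open>T (f p) q\<close>, which makes traces on tensor products and
  induced spaces finite sums that can be manipulated directly.\<close>

definition lagrange_basis :: "('x \<Rightarrow> complex) set \<Rightarrow> 'x set \<Rightarrow> ('x \<Rightarrow> 'x \<Rightarrow> complex) \<Rightarrow> bool" where
  "lagrange_basis V X f \<longleftrightarrow> cfun.subspace V \<and> finite X \<and> (\<forall>p\<in>X. f p \<in> V) \<and>
     (\<forall>p\<in>X. \<forall>q\<in>X. f p q = (if p = q then 1 else 0)) \<and>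
     (\<forall>v\<in>V. v = (\<Sum>p\<in>X. cscale (v p) (f p)))"

lemma cscale_apply: "cscale c f z = c * f z"
  by (simp add: cscale_def)

lemma sum_fun_apply: "(\<Sum>p\<in>X. F p) z = (\<Sum>p\<in>X. F p z :: complex)"
  by (induction X rule: infinite_finite_induct) auto

lemma lagrange_basisD:
  assumes "lagrange_basis V X f"
  shows "cfun.subspace V" "finite X" "\<And>p. p \<in> X \<Longrightarrow> f p \<in> V"
    "\<And>p q. p \<in> X \<Longrightarrow> q \<in> X \<Longrightarrow> f p q = (if p = q then 1 else 0)"
    "\<And>v. v \<in> V \<Longrightarrow> v = (\<Sum>p\<in>X. cscale (v p) (f p))"
    "\<And>v z. v \<in> V \<Longrightarrow> v z = (\<Sum>p\<in>X. v p * f p z)"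
proof -
  show 1: "v = (\<Sum>p\<in>X. cscale (v p) (f p))" if "v \<in> V" for v
    using assms that unfolding lagrange_basis_def by blast
  show "v z = (\<Sum>p\<in>X. v p * f p z)" if "v \<in> V" for v z
    using fun_cong[OF 1[OF that], of z] by (simp add: sum_fun_apply cscale_apply)
qed (use assms in \<open>auto simp: lagrange_basis_def\<close>)

lemma lagrange_basisI:
  assumes "cfun.subspace V" "finite X" "\<And>p. p \<in> X \<Longrightarrow> f p \<in> V"
    "\<And>p q. p \<in> X \<Longrightarrow> q \<in> X \<Longrightarrow> f p q = (if p = q then 1 else 0)"
    "\<And>v z. v \<in> V \<Longrightarrow> v z = (\<Sum>p\<in>X. v p * f p z)"
  shows "lagrange_basis V X f"
  unfolding lagrange_basis_def using assms by (simp add: fun_eq_iff sum_fun_apply cscale_apply)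

text \<open>Induction on the common support: vanishing at \<open>s\<close> cuts out a subspace of
  codimension at most one. If it is proper, one more function is added to its basis, normalised at
  \<open>s\<close> and cleared at the old points.\<close>

lemma lagrange_basis_exists:
  assumes "finite S" "cfun.subspace V" "\<And>v p. v \<in> V \<Longrightarrow> p \<notin> S \<Longrightarrow> v p = 0"
  shows "\<exists>X f. X \<subseteq> S \<and> lagrange_basis V X f"
  using assms
proof (induction S arbitrary: V rule: finite_induct)
  case empty
  have "v z = 0" if "v \<in> V" for v z using empty that by auto
  then show ?case by (intro exI[of _ "{}"]) (auto intro!: lagrange_basisI empty)
next
  case (insert s S)
  define V' where "V' = {v \<in> V. v s = 0}"
  have sub': "cfun.subspace V'"
    by (rule cfun.subspaceI)
      (use cfun.subspace_0[OF insert.prems(1)] cfun.subspace_add[OF insert.prems(1)]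
         cfun.subspace_scale[OF insert.prems(1)] in \<open>auto simp: V'_def cscale_apply\<close>)
  have van: "v p = 0" if "v \<in> V'" "p \<notin> S" for v p
    using that insert.prems(2)[of v p] by (cases "p = s") (auto simp: V'_def)
  have "\<exists>X f. X \<subseteq> S \<and> lagrange_basis V' X f"
    by (rule insert.IH[OF sub']) (rule van)
  then obtain X f where X: "X \<subseteq> S" "lagrange_basis V' X f" by blast
  note L = lagrange_basisD[OF X(2)]
  show ?case
  proof (cases "V' = V")
    case True
    then show ?thesis using X by blast
  next
    case False
    then obtain v0 where v0: "v0 \<in> V" "v0 s \<noteq> 0" by (auto simp: V'_def)
    define v1 where "v1 = cscale (1 / v0 s) v0"
    have v1: "v1 \<in> V" "v1 s = 1"
      using v0 cfun.subspace_scale[OF insert.prems(1) v0(1)] by (simp_all add: v1_def cscale_apply)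
    \<comment> \<open>Subtracting the interpolation of \<open>v1\<close> at \<open>X\<close> clears
      the points of \<open>X\<close>. The value 1 at \<open>s\<close> is kept because the old basis
      functions vanish there, which is also why they need no correction themselves.\<close>
    define fs where "fs = v1 - (\<Sum>p\<in>X. cscale (v1 p) (f p))"
    have fV: "f p \<in> V" "f p s = 0" if "p \<in> X" for p using L(3)[OF that] by (auto simp: V'_def)
    have fs: "fs \<in> V" unfolding fs_def
      by (intro cfun.subspace_diff cfun.subspace_sum cfun.subspace_scale insert.prems v1 fV)
    have fss: "fs s = 1" using v1 fV by (simp add: fs_def sum_fun_apply cscale_apply)
    have fsX: "fs p = 0" if "p \<in> X" for p
    proof -
      have "fs p = v1 p - (\<Sum>q\<in>X. v1 q * (if q = p then 1 else 0))"
        using L(4) that by (simp add: fs_def sum_fun_apply cscale_apply)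
      then show ?thesis using that L(2) by (simp add: if_distrib sum.delta cong: if_cong)
    qed
    have sX: "s \<notin> X" using X insert.hyps by blast
    define f' where "f' = f(s := fs)"
    have f': "f' p = f p" if "p \<in> X" for p using that sX by (auto simp: f'_def)
    have f's: "f' s = fs" by (simp add: f'_def)
    have "lagrange_basis V (insert s X) f'"
    proof (rule lagrange_basisI)
      fix p q assume pq: "p \<in> insert s X" "q \<in> insert s X"
      show "f' p \<in> V" using pq fs fV f' f's by auto
      show "f' p q = (if p = q then 1 else 0)"
        using pq sX fss fsX fV L(4) f' f's by auto
    next
      fix v z assume v: "v \<in> V"
      \<comment> \<open>Removing the part along \<open>fs\<close> lands in the smaller space, whose
        expansion applies; the values on \<open>X\<close> are unchanged since \<open>fs\<close>
        vanishes there.\<close>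
      define u where "u = v - cscale (v s) fs"
      have "u \<in> V'" unfolding V'_def u_def using fss
        by (auto intro!: cfun.subspace_diff cfun.subspace_scale insert.prems v fs simp: cscale_apply)
      then have "u z = (\<Sum>p\<in>X. u p * f p z)" by (rule L(6))
      also have "\<dots> = (\<Sum>p\<in>X. v p * f' p z)"
        by (rule sum.cong[OF refl]) (simp add: u_def fsX f' cscale_apply)
      finally have "v z = v s * fs z + (\<Sum>p\<in>X. v p * f' p z)" by (simp add: u_def cscale_apply algebra_simps)
      then show "v z = (\<Sum>p\<in>insert s X. v p * f' p z)" using sX L(2) f's by simp
    qed (use insert.prems L(2) in auto)
    then show ?thesis using X by blast
  qed
qed

section \<open>Dimension, determinant and trace from bases dual to evaluations\<close>

lemma lagrange_ordered_basis:
  assumes L: "lagrange_basis V X f" and xs: "set xs = X" "distinct xs"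
  shows "ordered_basis V (map f xs)"
proof -
  note D = lagrange_basisD[OF L]
  have inj: "inj_on f X"
  proof
    fix p q assume "p \<in> X" "q \<in> X" "f p = f q"
    then show "p = q" using D(4)[of p q] D(4)[of q q] by (auto split: if_splits)
  qed
  have ind: "cfun.independent (f ` X)"
  proof (rule cfun.independent_if_scalars_zero)
    show "finite (f ` X)" using D(2) by simp
    fix c v assume s: "(\<Sum>x\<in>f ` X. cscale (c x) x) = 0" and v: "v \<in> f ` X"
    obtain p where p: "p \<in> X" "v = f p" using v by blast
    have "0 = (\<Sum>x\<in>f ` X. cscale (c x) x) p" using s by simp
    also have "\<dots> = (\<Sum>q\<in>X. c (f q) * f q p)"
      using inj by (simp add: sum.reindex sum_fun_apply cscale_apply)
    also have "\<dots> = (\<Sum>q\<in>X. if q = p then c (f p) else 0)"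
      by (rule sum.cong[OF refl]) (use D(4) p in auto)
    also have "\<dots> = c v" using p D(2) by simp
    finally show "c v = 0" by simp
  qed
  have span: "cfun.span (f ` X) = V"
  proof
    show "cfun.span (f ` X) \<subseteq> V" using D(1,3) by (intro cfun.span_minimal) auto
    show "V \<subseteq> cfun.span (f ` X)"
    proof
      fix v assume "v \<in> V"
      from D(5)[OF this] show "v \<in> cfun.span (f ` X)"
        by (metis (no_types, lifting) cfun.span_sum cfun.span_scale cfun.span_base imageI)
    qed
  qed
  show ?thesis unfolding ordered_basis_def using xs inj ind span by (auto simp: distinct_map)
qed

lemma ordered_basis_dim:
  assumes "ordered_basis V bs"
  shows "cfun.dim V = length bs"
  using assms cfun.dim_eq_card_independent[of "set bs"] cfun.dim_span[of "set bs"]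
  by (auto simp: ordered_basis_def distinct_card)

lemma lagrange_dim:
  assumes L: "lagrange_basis V X f"
  shows "cfun.dim V = card X"
proof -
  obtain xs where xs: "set xs = X" "distinct xs"
    using finite_distinct_list[OF lagrange_basisD(2)[OF L]] by blast
  show ?thesis using ordered_basis_dim[OF lagrange_ordered_basis[OF L xs]] xs
    by (simp add: distinct_card[symmetric])
qed

definition sample_mat ::
  "'x list \<Rightarrow> ('x \<Rightarrow> 'x \<Rightarrow> complex) \<Rightarrow> (('x \<Rightarrow> complex) \<Rightarrow> ('x \<Rightarrow> complex)) \<Rightarrow> complex mat" where
  "sample_mat xs f T = mat (length xs) (length xs) (\<lambda>(i, j). T (f (xs ! j)) (xs ! i))"

lemma sample_mat_carrier [simp]: "sample_mat xs f T \<in> carrier_mat (length xs) (length xs)"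
  by (simp add: sample_mat_def)

lemma linear_apply_sum:
  assumes "Vector_Spaces.linear cscale cscale T"
  shows "T (\<Sum>p\<in>X. cscale (c p) (g p)) z = (\<Sum>p\<in>X. c p * (T (g p) z :: complex))"
proof -
  interpret T: Vector_Spaces.linear cscale cscale T by fact
  have "T (\<Sum>p\<in>X. cscale (c p) (g p)) = (\<Sum>p\<in>X. cscale (c p) (T (g p)))"
    by (simp add: T.sum T.scale)
  then show ?thesis by (simp add: sum_fun_apply) (simp add: cscale_apply)
qed

text \<open>This frees \<open>det_on\<close> and \<open>trace_on\<close> from the basis chosen by
  \<open>SOME\<close>. \<open>P\<close> holds the values of the arbitrary basis at the sample points
  and \<open>Q\<close> the coordinates of the dual basis; they are the two base changes. The
  relation \<open>P * M = N * P\<close> holds because both sides evaluate the images of the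
  arbitrary basis vectors at the sample points.\<close>

lemma matrix_on_similar_sample_mat:
  assumes L: "lagrange_basis V X f" and xs: "set xs = X" "distinct xs"
    and bs: "ordered_basis V bs"
    and T: "Vector_Spaces.linear cscale cscale T" "\<And>v. v \<in> V \<Longrightarrow> T v \<in> V"
  shows "similar_mat (matrix_on bs T) (sample_mat xs f T)"
proof -
  define n where "n = length xs"
  note D = lagrange_basisD[OF L]
  have len: "length bs = n"
    using ordered_basis_dim[OF bs] ordered_basis_dim[OF lagrange_ordered_basis[OF L xs]]
    by (simp add: n_def)
  have bs': "cfun.independent (set bs)" "cfun.span (set bs) = V" "distinct bs"
    using bs by (auto simp: ordered_basis_def)
  have bsV: "bs ! k \<in> V" if "k < n" for k
    using that len bs'(2) by (auto intro!: cfun.span_base)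
  have nthV: "xs ! k \<in> X" if "k < n" for k using that xs by (auto simp: n_def)
  have rep: "(\<Sum>k<n. cfun.representation (set bs) v (bs ! k) * (bs ! k) z) = v z" if "v \<in> V" for v z
  proof -
    have "v z = (\<Sum>b\<in>set bs. cscale (cfun.representation (set bs) v b) b) z"
      using cfun.sum_representation_eq[OF bs'(1), of v "set bs"] that bs'(2) by simp
    also have "\<dots> = (\<Sum>b\<in>set bs. cfun.representation (set bs) v b * b z)"
      by (simp add: sum_fun_apply cscale_apply)
    also have "\<dots> = (\<Sum>k<n. cfun.representation (set bs) v (bs ! k) * (bs ! k) z)"
      using sum.reindex_bij_betw[OF bij_betw_nth[OF bs'(3) refl refl],
        of "\<lambda>b. cfun.representation (set bs) v b * b z"] len by simp
    finally show ?thesis by simp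
  qed
  have sumX: "(\<Sum>p\<in>X. g p) = (\<Sum>k<n. g (xs ! k))" for g :: "_ \<Rightarrow> complex"
    using sum.reindex_bij_betw[OF bij_betw_nth[OF xs(2) refl xs(1)[symmetric]], of g]
    by (simp add: n_def)
  define P where "P = mat n n (\<lambda>(i, j). (bs ! j) (xs ! i))"
  define Q where "Q = mat n n (\<lambda>(i, j). cfun.representation (set bs) (f (xs ! j)) (bs ! i))"
  define M where "M = matrix_on bs T"
  define N where "N = sample_mat xs f T"
  have car: "P \<in> carrier_mat n n" "Q \<in> carrier_mat n n" "M \<in> carrier_mat n n" "N \<in> carrier_mat n n"
    using len by (auto simp: P_def Q_def M_def N_def matrix_on_def sample_mat_def n_def)
  have PQ: "P * Q = 1\<^sub>m n"
  proof (rule eq_matI)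
    fix i j assume ij: "i < dim_row (1\<^sub>m n)" "j < dim_col (1\<^sub>m n)"
    then have "(P * Q) $$ (i, j) = f (xs ! j) (xs ! i)"
      using rep[OF D(3)[OF nthV], of j "xs ! i"]
      by (simp add: P_def Q_def scalar_prod_def atLeast0LessThan mult.commute)
    also have "\<dots> = 1\<^sub>m n $$ (i, j)"
      using D(4)[OF nthV nthV, of j i] ij xs(2) by (auto simp: n_def nth_eq_iff_index_eq)
    finally show "(P * Q) $$ (i, j) = 1\<^sub>m n $$ (i, j)" .
  qed (use car in auto)
  have QP: "Q * P = 1\<^sub>m n" by (rule mat_mult_left_right_inverse[OF car(1,2) PQ])
  have PM: "P * M = N * P"
  proof (rule eq_matI)
    fix i j assume "i < dim_row (N * P)" "j < dim_col (N * P)"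
    then have ij: "i < n" "j < n" using car by auto
    have "(P * M) $$ (i, j) = T (bs ! j) (xs ! i)"
      using rep[OF T(2)[OF bsV], of j "xs ! i"] ij len
      by (simp add: P_def M_def matrix_on_def scalar_prod_def atLeast0LessThan mult.commute)
    also have "\<dots> = T (\<Sum>p\<in>X. cscale ((bs ! j) p) (f p)) (xs ! i)"
      using D(5)[OF bsV[OF ij(2)]] by simp
    also have "\<dots> = (\<Sum>p\<in>X. (bs ! j) p * T (f p) (xs ! i))" by (rule linear_apply_sum[OF T(1)])
    also have "\<dots> = (N * P) $$ (i, j)"
      using ij by (simp add: sumX P_def N_def sample_mat_def n_def[symmetric] scalar_prod_def
        atLeast0LessThan mult.commute)
    finally show "(P * M) $$ (i, j) = (N * P) $$ (i, j)" .
  qed (use car in auto)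
  have "M = (Q * P) * M" using QP car by simp
  also have "\<dots> = Q * N * P" using PM car by (simp add: assoc_mult_mat[of _ n n _ n _ n])
  finally have "M = Q * N * P" .
  then have "similar_mat M N" using car PQ QP by (intro similar_matI[of _ _ Q P n]) auto
  then show ?thesis by (simp add: M_def N_def)
qed

lemma some_ordered_basis:
  assumes L: "lagrange_basis V X f"
  shows "ordered_basis V (SOME bs. ordered_basis V bs)"
  using lagrange_ordered_basis[OF L] finite_distinct_list[OF lagrange_basisD(2)[OF L]]
  by (metis someI_ex)

lemma det_on_lagrange:
  assumes "lagrange_basis V X f" "set xs = X" "distinct xs"
    and "Vector_Spaces.linear cscale cscale T" "\<And>v. v \<in> V \<Longrightarrow> T v \<in> V"
  shows "det_on V T = det (sample_mat xs f T)"
  unfolding det_on_def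
  by (rule det_similar, rule matrix_on_similar_sample_mat[OF assms(1-3) some_ordered_basis[OF assms(1)] assms(4,5)])

lemma trace_sample_mat:
  assumes "set xs = X" "distinct xs"
  shows "mat_trace (sample_mat xs f T) = (\<Sum>p\<in>X. T (f p) p)"
  using sum.reindex_bij_betw[OF bij_betw_nth[OF assms(2) refl assms(1)[symmetric]], of "\<lambda>p. T (f p) p"]
  by (simp add: mat_trace_def sample_mat_def)

lemma trace_on_lagrange:
  assumes L: "lagrange_basis V X f"
    and T: "Vector_Spaces.linear cscale cscale T" "\<And>v. v \<in> V \<Longrightarrow> T v \<in> V"
  shows "trace_on V T = (\<Sum>p\<in>X. T (f p) p)"
proof -
  obtain xs where xs: "set xs = X" "distinct xs"
    using finite_distinct_list[OF lagrange_basisD(2)[OF L]] by blast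
  have "trace_on V T = mat_trace (matrix_on (SOME bs. ordered_basis V bs) T)"
    by (simp add: trace_on_def Let_def mat_trace_def)
  also have "\<dots> = mat_trace (sample_mat xs f T)"
    by (rule mat_trace_similar, rule matrix_on_similar_sample_mat[OF L xs some_ordered_basis[OF L] T])
  finally show ?thesis by (simp add: trace_sample_mat[OF xs])
qed

lemma sample_mat_mult:
  assumes L: "lagrange_basis V X f" and xs: "set xs = X" "distinct xs"
    and S: "Vector_Spaces.linear cscale cscale S"
    and T: "\<And>v. v \<in> V \<Longrightarrow> T v \<in> V"
  shows "sample_mat xs f S * sample_mat xs f T = sample_mat xs f (\<lambda>v. S (T v))"
proof (rule eq_matI)
  note D = lagrange_basisD[OF L]
  fix i j assume "i < dim_row (sample_mat xs f (\<lambda>v. S (T v)))" "j < dim_col (sample_mat xs f (\<lambda>v. S (T v)))"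
  then have ij: "i < length xs" "j < length xs" by (auto simp: sample_mat_def)
  then have jX: "xs ! j \<in> X" using xs by auto
  have "S (T (f (xs ! j))) (xs ! i) = S (\<Sum>p\<in>X. cscale (T (f (xs ! j)) p) (f p)) (xs ! i)"
    using D(5)[OF T[OF D(3)[OF jX]]] by simp
  also have "\<dots> = (\<Sum>p\<in>X. T (f (xs ! j)) p * S (f p) (xs ! i))"
    by (rule linear_apply_sum[OF S])
  also have "\<dots> = (\<Sum>k<length xs. T (f (xs ! j)) (xs ! k) * S (f (xs ! k)) (xs ! i))"
    using sum.reindex_bij_betw[OF bij_betw_nth[OF xs(2) refl xs(1)[symmetric]],
      of "\<lambda>p. T (f (xs ! j)) p * S (f p) (xs ! i)"] by simp
  finally show "(sample_mat xs f S * sample_mat xs f T) $$ (i, j)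
      = sample_mat xs f (\<lambda>v. S (T v)) $$ (i, j)"
    using ij by (simp add: sample_mat_def scalar_prod_def atLeast0LessThan mult.commute)
qed (auto simp: sample_mat_def)

lemma linear_compose_cscale:
  assumes "Vector_Spaces.linear cscale cscale S" "Vector_Spaces.linear cscale cscale T"
  shows "Vector_Spaces.linear cscale cscale (\<lambda>v. S (T v))"
  using Vector_Spaces.linear_compose[OF assms(2,1)] by (simp add: comp_def)

lemma det_on_compose:
  assumes L: "lagrange_basis V X f"
    and S: "Vector_Spaces.linear cscale cscale S" "\<And>v. v \<in> V \<Longrightarrow> S v \<in> V"
    and T: "Vector_Spaces.linear cscale cscale T" "\<And>v. v \<in> V \<Longrightarrow> T v \<in> V"
  shows "det_on V (\<lambda>v. S (T v)) = det_on V S * det_on V T"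
proof -
  obtain xs where xs: "set xs = X" "distinct xs"
    using finite_distinct_list[OF lagrange_basisD(2)[OF L]] by blast
  have "det_on V (\<lambda>v. S (T v)) = det (sample_mat xs f S * sample_mat xs f T)"
    using det_on_lagrange[OF L xs linear_compose_cscale[OF S(1) T(1)]] S T
    by (simp add: sample_mat_mult[OF L xs S(1) T(2)])
  also have "\<dots> = det_on V S * det_on V T"
    using det_mult[OF sample_mat_carrier sample_mat_carrier]
    by (simp add: det_on_lagrange[OF L xs S] det_on_lagrange[OF L xs T])
  finally show ?thesis .
qed

lemma trace_on_comm:
  assumes L: "lagrange_basis V X f"
    and S: "Vector_Spaces.linear cscale cscale S" "\<And>v. v \<in> V \<Longrightarrow> S v \<in> V"
    and T: "Vector_Spaces.linear cscale cscale T" "\<And>v. v \<in> V \<Longrightarrow> T v \<in> V"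
  shows "trace_on V (\<lambda>v. S (T v)) = trace_on V (\<lambda>v. T (S v))"
proof -
  obtain xs where xs: "set xs = X" "distinct xs"
    using finite_distinct_list[OF lagrange_basisD(2)[OF L]] by blast
  have "trace_on V (\<lambda>v. S (T v)) = mat_trace (sample_mat xs f (\<lambda>v. S (T v)))"
    using trace_on_lagrange[OF L linear_compose_cscale[OF S(1) T(1)]] S T
    by (simp add: trace_sample_mat[OF xs])
  also have "\<dots> = mat_trace (sample_mat xs f (\<lambda>v. T (S v)))"
    by (subst (1 2) sample_mat_mult[OF L xs, symmetric]) (use S T in \<open>auto intro!: mat_trace_comm sample_mat_carrier\<close>)
  also have "\<dots> = trace_on V (\<lambda>v. T (S v))"
    using trace_on_lagrange[OF L linear_compose_cscale[OF T(1) S(1)]] S T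
    by (simp add: trace_sample_mat[OF xs])
  finally show ?thesis .
qed

lemma det_on_diagonal:
  assumes L: "lagrange_basis V X f"
    and T: "Vector_Spaces.linear cscale cscale T" "\<And>v. v \<in> V \<Longrightarrow> T v \<in> V"
    and diag: "\<And>p q. p \<in> X \<Longrightarrow> q \<in> X \<Longrightarrow> T (f p) q = (if p = q then c p else 0)"
  shows "det_on V T = (\<Prod>p\<in>X. c p)"
proof -
  obtain xs where xs: "set xs = X" "distinct xs"
    using finite_distinct_list[OF lagrange_basisD(2)[OF L]] by blast
  have diag': "sample_mat xs f T $$ (i, j) = (if i = j then c (xs ! i) else 0)"
    if "i < length xs" "j < length xs" for i j
    using that diag[of "xs ! j" "xs ! i"] xs by (auto simp: sample_mat_def nth_eq_iff_index_eq)
  have "det (sample_mat xs f T) = prod_list (diag_mat (sample_mat xs f T))"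
    by (rule det_upper_triangular[OF upper_triangularI sample_mat_carrier]) (simp add: diag' carrier_matD[OF sample_mat_carrier])
  also have "\<dots> = (\<Prod>k<length xs. c (xs ! k))"
    unfolding prod_list_diag_prod
    using diag' by (intro prod.cong) (auto simp: carrier_matD[OF sample_mat_carrier])
  also have "\<dots> = (\<Prod>p\<in>X. c p)"
    using prod.reindex_bij_betw[OF bij_betw_nth[OF xs(2) refl xs(1)[symmetric]], of c] by simp
  finally show ?thesis using det_on_lagrange[OF L xs T] by simp
qed

lemma det_on_id:
  assumes L: "lagrange_basis V X f" and T: "Vector_Spaces.linear cscale cscale T" "\<And>v. v \<in> V \<Longrightarrow> T v = v"
  shows "det_on V T = 1"
  using det_on_diagonal[OF L T(1), of "\<lambda>_. 1"] T lagrange_basisD(3,4)[OF L] by simp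

lemma det_on_involution:
  assumes L: "lagrange_basis V X f"
    and T: "Vector_Spaces.linear cscale cscale T" "\<And>v. v \<in> V \<Longrightarrow> T v \<in> V"
    and inv: "\<And>v. v \<in> V \<Longrightarrow> T (T v) = v"
  shows "\<exists>m. det_on V T = (-1) ^ m \<and> of_nat (card X) - (\<Sum>p\<in>X. T (f p) p) = 2 * of_nat m"
proof -
  obtain xs where xs: "set xs = X" "distinct xs"
    using finite_distinct_list[OF lagrange_basisD(2)[OF L]] by blast
  have "sample_mat xs f T * sample_mat xs f T = sample_mat xs f (\<lambda>v. T (T v))"
    by (rule sample_mat_mult[OF L xs T])
  also have "\<dots> = 1\<^sub>m (length xs)"
    by (rule eq_matI) (use inv lagrange_basisD(3,4)[OF L] xs in \<open>auto simp: sample_mat_def nth_eq_iff_index_eq\<close>)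
  finally have "sample_mat xs f T * sample_mat xs f T = 1\<^sub>m (length xs)" .
  from det_involution[OF sample_mat_carrier this] show ?thesis
    using det_on_lagrange[OF L xs T] xs by (simp add: trace_sample_mat[OF xs] distinct_card[symmetric])
qed

section \<open>Tensor products and induced representations\<close>

lemma linearI_cscale:
  assumes "\<And>u v. T (u + v) = T u + T v" "\<And>c v. T (cscale c v) = cscale c (T v)"
  shows "Vector_Spaces.linear cscale cscale T"
  unfolding Vector_Spaces.linear_iff using assms by (simp add: cfun.vector_space_axioms)

lemma linear_eq_on_cspan:
  assumes "Vector_Spaces.linear cscale cscale L" "Vector_Spaces.linear cscale cscale L'"
    and "\<And>x. x \<in> S \<Longrightarrow> L x = L' x" and "v \<in> cfun.span S"
  shows "L v = L' v"
proof -
  interpret L: Vector_Spaces.linear cscale cscale L by fact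
  interpret L': Vector_Spaces.linear cscale cscale L' by fact
  show ?thesis using assms(4)
  proof (induction rule: cfun.span_induct)
    show "cfun.subspace {x. L x = L' x}"
      by (rule cfun.subspaceI) (auto simp: L.add L'.add L.scale L'.scale L.zero L'.zero)
  qed (rule assms(3))
qed

lemma linear_image_cspan:
  assumes "Vector_Spaces.linear cscale cscale L"
    and "\<And>x. x \<in> S \<Longrightarrow> L x \<in> cfun.span S'" and "v \<in> cfun.span S"
  shows "L v \<in> cfun.span S'"
proof -
  interpret L: Vector_Spaces.linear cscale cscale L by fact
  show ?thesis using assms(3)
  proof (induction rule: cfun.span_induct)
    show "cfun.subspace {x. L x \<in> cfun.span S'}"
      by (rule cfun.subspaceI)
        (auto simp: L.add L.scale L.zero cfun.span_zero intro: cfun.span_add cfun.span_scale)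
  qed (rule assms(2))
qed

text \<open>Interpolation in several variables: the sample points are the tuples of sample points,
  and the dual basis consists of pure tensors of the dual bases. The expansion formula is linear in
  \<open>v\<close>, so it suffices to verify it on pure tensors.\<close>

lemma lagrange_tensor:
  assumes K: "finite K" and L: "\<And>k. k \<in> K \<Longrightarrow> lagrange_basis (V k) (X k) (f k)"
  shows "lagrange_basis (tensor_space K V) (PiE K X) (\<lambda>\<xi>. pure_tensor K (\<lambda>k. f k (\<xi> k)))"
proof (rule lagrange_basisI)
  note D = lagrange_basisD[OF L]
  show "cfun.subspace (tensor_space K V)" by (simp add: tensor_space_def cfun.subspace_span)
  show "finite (PiE K X)" using K D(2) by (intro finite_PiE) auto
  show "pure_tensor K (\<lambda>k. f k (\<xi> k)) \<in> tensor_space K V" if "\<xi> \<in> PiE K X" for \<xi>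
    unfolding tensor_space_def using that D(3) by (intro cfun.span_base) (auto simp: PiE_iff)
  fix \<xi> \<eta> assume xe: "\<xi> \<in> PiE K X" "\<eta> \<in> PiE K X"
  have "(\<Prod>k\<in>K. f k (\<xi> k) (\<eta> k)) = (\<Prod>k\<in>K. if \<xi> k = \<eta> k then 1 else 0)"
    using xe D(4) by (intro prod.cong) (auto simp: PiE_iff)
  also have "\<dots> = (if \<xi> = \<eta> then 1 else 0)"
  proof (cases "\<xi> = \<eta>")
    case False
    then obtain k where "k \<in> K" "\<xi> k \<noteq> \<eta> k" using PiE_ext[OF xe] by blast
    then show ?thesis using False K by (auto intro!: prod_zero)
  qed simp
  finally show "pure_tensor K (\<lambda>k. f k (\<xi> k)) \<eta> = (if \<xi> = \<eta> then 1 else 0)"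
    using xe by (simp add: pure_tensor_def PiE_iff)
next
  note D = lagrange_basisD[OF L]
  define b where "b = (\<lambda>\<xi>. pure_tensor K (\<lambda>k. f k (\<xi> k)))"
  define E where "E = PiE K X"
  fix v z assume v: "v \<in> tensor_space K V"
  have "\<forall>z. v z = (\<Sum>\<xi>\<in>E. v \<xi> * b \<xi> z)"
    using v unfolding tensor_space_def
  proof (induction rule: cfun.span_induct)
    show "cfun.subspace {v. \<forall>z. v z = (\<Sum>\<xi>\<in>E. v \<xi> * b \<xi> z)}"
    proof (rule cfun.subspaceI)
      fix u v assume *: "u \<in> {v. \<forall>z. v z = (\<Sum>\<xi>\<in>E. v \<xi> * b \<xi> z)}" "v \<in> {v. \<forall>z. v z = (\<Sum>\<xi>\<in>E. v \<xi> * b \<xi> z)}"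
      have "u z + v z = (\<Sum>\<xi>\<in>E. (u \<xi> + v \<xi>) * b \<xi> z)" for z
      proof -
        have "u z = (\<Sum>\<xi>\<in>E. u \<xi> * b \<xi> z)" "v z = (\<Sum>\<xi>\<in>E. v \<xi> * b \<xi> z)" using * by blast+
        from arg_cong2[OF this, of "(+)"] show ?thesis by (simp only: distrib_right sum.distrib)
      qed
      then show "u + v \<in> {v. \<forall>z. v z = (\<Sum>\<xi>\<in>E. v \<xi> * b \<xi> z)}"
        unfolding mem_Collect_eq plus_fun_def by blast
    next
      fix c v assume *: "v \<in> {v. \<forall>z. v z = (\<Sum>\<xi>\<in>E. v \<xi> * b \<xi> z)}"
      have "c * v z = (\<Sum>\<xi>\<in>E. c * v \<xi> * b \<xi> z)" for z
      proof -
        have "v z = (\<Sum>\<xi>\<in>E. v \<xi> * b \<xi> z)" using * by blast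
        from arg_cong[OF this, of "(*) c"] show ?thesis by (simp only: mult.assoc sum_distrib_left)
      qed
      then show "cscale c v \<in> {v. \<forall>z. v z = (\<Sum>\<xi>\<in>E. v \<xi> * b \<xi> z)}"
        unfolding mem_Collect_eq cscale_def by blast
    qed simp
  next
    fix v assume "v \<in> {pure_tensor K v |v. \<forall>k\<in>K. v k \<in> V k}"
    then obtain u where u: "v = pure_tensor K u" "\<And>k. k \<in> K \<Longrightarrow> u k \<in> V k" by blast
    show "\<forall>z. v z = (\<Sum>\<xi>\<in>E. v \<xi> * b \<xi> z)"
    proof
      fix z
      show "v z = (\<Sum>\<xi>\<in>E. v \<xi> * b \<xi> z)"
      proof (cases "z \<in> extensional K")
        case True
        then have "v z = (\<Prod>k\<in>K. u k (z k))" by (simp add: u(1) pure_tensor_def)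
        also have "\<dots> = (\<Prod>k\<in>K. \<Sum>p\<in>X k. u k p * f k p (z k))"
          by (rule prod.cong[OF refl]) (rule D(6)[OF _ u(2)])
        \<comment> \<open>Multiplying out the one-variable expansions: choosing a summand in every
          factor amounts to choosing a point of the product.\<close>
        also have "\<dots> = (\<Sum>\<xi>\<in>PiE K X. \<Prod>k\<in>K. u k (\<xi> k) * f k (\<xi> k) (z k))"
          by (rule prod_sum_PiE[OF K]) (rule D(2))
        also have "\<dots> = (\<Sum>\<xi>\<in>E. v \<xi> * b \<xi> z)"
          using True by (intro sum.cong) (auto simp: u(1) b_def E_def pure_tensor_def PiE_iff prod.distrib)
        finally show ?thesis .
      next
        case False
        then show ?thesis by (simp add: u(1) b_def pure_tensor_def)
      qed
    qed
  qed
  then show "v z = (\<Sum>\<xi>\<in>PiE K X. v \<xi> * pure_tensor K (\<lambda>k. f k (\<xi> k)) z)"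
    unfolding b_def E_def by blast
qed

lemma tensor_map_linear:
  assumes "Vector_Spaces.linear cscale cscale L"
    and "\<And>v. (\<And>k. k \<in> K \<Longrightarrow> v k \<in> V k) \<Longrightarrow> L (pure_tensor K v) = pure_tensor K (\<lambda>k. A k (v k))"
  shows "Vector_Spaces.linear cscale cscale (tensor_map K V A)"
proof -
  let ?P = "\<lambda>L. Vector_Spaces.linear cscale cscale L \<and>
     (\<forall>v. (\<forall>k\<in>K. v k \<in> V k) \<longrightarrow> L (pure_tensor K v) = pure_tensor K (\<lambda>k. A k (v k)))"
  have "?P L" using assms by blast
  then have "?P (tensor_map K V A)" unfolding tensor_map_def by (rule someI[where P = ?P])
  then show ?thesis by blast
qed

text \<open>Any operator \<open>L\<close> with the defining property shows that the
  \<open>SOME\<close> in \<open>tensor_map\<close> is attained; as pure tensors span, the chosen map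
  agrees with \<open>L\<close> on the tensor space, though possibly nowhere else.\<close>

lemma tensor_map_eq:
  assumes L: "Vector_Spaces.linear cscale cscale L"
    "\<And>v. (\<And>k. k \<in> K \<Longrightarrow> v k \<in> V k) \<Longrightarrow> L (pure_tensor K v) = pure_tensor K (\<lambda>k. A k (v k))"
    and F: "F \<in> tensor_space K V"
  shows "tensor_map K V A F = L F"
  by (rule linear_eq_on_cspan[OF tensor_map_linear[OF L] L(1) _ F[unfolded tensor_space_def]])
    (auto simp: tensor_map_pure_tensor[OF L] L(2))

text \<open>\<open>U\<close> is a transversal of the left cosets of \<open>H\<close>: the condition
  \<open>inv u \<otimes> c \<in> H\<close> says that \<open>u\<close> and \<open>c\<close> lie in
  the same coset. Linearity is asked on the whole function space, but the action laws only on
  \<open>rep_space \<sigma>\<close>, because an action built from \<open>tensor_map\<close> is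
  unspecified elsewhere.\<close>

locale induced_lagrange = group G + subgroup H G for G (structure) and H +
  fixes \<sigma> :: "('g, 'x) rep" and U :: "'g set" and Y :: "'x set" and e :: "'x \<Rightarrow> 'x \<Rightarrow> complex"
  assumes lin: "\<And>h. h \<in> H \<Longrightarrow> Vector_Spaces.linear cscale cscale (rep_act \<sigma> h)"
    and closed: "\<And>h F. h \<in> H \<Longrightarrow> F \<in> rep_space \<sigma> \<Longrightarrow> rep_act \<sigma> h F \<in> rep_space \<sigma>"
    and act_mult: "\<And>h h' F. h \<in> H \<Longrightarrow> h' \<in> H \<Longrightarrow> F \<in> rep_space \<sigma> \<Longrightarrow>
      rep_act \<sigma> (h \<otimes> h') F = rep_act \<sigma> h (rep_act \<sigma> h' F)"
    and act_one: "\<And>F. F \<in> rep_space \<sigma> \<Longrightarrow> rep_act \<sigma> \<one> F = F"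
    and basis: "lagrange_basis (rep_space \<sigma>) Y e"
    and U: "finite U" "U \<subseteq> carrier G"
    and U_ex: "\<And>u. u \<in> carrier G \<Longrightarrow> \<exists>c\<in>U. inv u \<otimes> c \<in> H"
    and U_unique: "\<And>c c'. c \<in> U \<Longrightarrow> c' \<in> U \<Longrightarrow> inv c \<otimes> c' \<in> H \<Longrightarrow> c = c'"
begin

abbreviation "V \<equiv> rep_space (induced_rep G H \<sigma>)"
abbreviation "act \<equiv> rep_act (induced_rep G H \<sigma>)"

text \<open>Supported on the coset of \<open>c\<close>, with value \<open>e \<xi>\<close> at \<open>c\<close> itself.\<close>

definition ind_fun :: "'g \<times> 'x \<Rightarrow> 'g \<times> 'x \<Rightarrow> complex" where
  "ind_fun = (\<lambda>(c, \<xi>) (u, x).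
     if u \<in> carrier G \<and> inv u \<otimes> c \<in> H then rep_act \<sigma> (inv u \<otimes> c) (e \<xi>) x else 0)"

lemma V_iff: "F \<in> V \<longleftrightarrow> (\<forall>u. u \<notin> carrier G \<longrightarrow> (\<forall>x. F (u, x) = 0)) \<and>
    (\<forall>u\<in>carrier G. (\<lambda>x. F (u, x)) \<in> rep_space \<sigma>) \<and>
    (\<forall>u\<in>carrier G. \<forall>h\<in>H. (\<lambda>x. F (u \<otimes> h, x)) = rep_act \<sigma> (inv h) (\<lambda>x. F (u, x)))"
  by (simp add: induced_rep_def)

lemma act_apply: "act g F (u, x) = (if u \<in> carrier G then F (inv g \<otimes> u, x) else 0)"
  by (simp add: induced_rep_def)

lemma act_zero: "h \<in> H \<Longrightarrow> rep_act \<sigma> h (\<lambda>_. 0) = (\<lambda>_. 0)"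
proof -
  assume "h \<in> H"
  then interpret L: Vector_Spaces.linear cscale cscale "rep_act \<sigma> h" by (rule lin)
  show ?thesis using L.zero by (simp add: zero_fun_def)
qed

lemma subspace_W: "cfun.subspace (rep_space \<sigma>)"
  using lagrange_basisD(1)[OF basis] .

lemma subspace_V: "cfun.subspace V"
proof (rule cfun.subspaceI)
  have z: "(\<lambda>_. 0) \<in> rep_space \<sigma>" using cfun.subspace_0[OF subspace_W] by (simp add: zero_fun_def)
  show "0 \<in> V" using z by (simp add: V_iff act_zero)
next
  fix F F' assume FF: "F \<in> V" "F' \<in> V"
  show "F + F' \<in> V"
    unfolding V_iff
  proof (intro conjI ballI allI impI)
    fix u assume u: "u \<in> carrier G"
    have "(\<lambda>x. F (u, x)) + (\<lambda>x. F' (u, x)) \<in> rep_space \<sigma>"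
      using FF u by (intro cfun.subspace_add[OF subspace_W]) (auto simp: V_iff)
    then show "(\<lambda>x. (F + F') (u, x)) \<in> rep_space \<sigma>" by (simp add: plus_fun_def)
    fix h assume h: "h \<in> H"
    then interpret L: Vector_Spaces.linear cscale cscale "rep_act \<sigma> (inv h)" by (intro lin) simp
    show "(\<lambda>x. (F + F') (u \<otimes> h, x)) = rep_act \<sigma> (inv h) (\<lambda>x. (F + F') (u, x))"
      using FF u h L.add[of "\<lambda>x. F (u, x)" "\<lambda>x. F' (u, x)"] by (simp add: V_iff plus_fun_def fun_eq_iff)
  qed (use FF in \<open>auto simp: V_iff\<close>)
next
  fix c F assume F: "F \<in> V"
  show "cscale c F \<in> V"
    unfolding V_iff
  proof (intro conjI ballI allI impI)
    fix u assume u: "u \<in> carrier G"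
    have "cscale c (\<lambda>x. F (u, x)) \<in> rep_space \<sigma>"
      using F u by (intro cfun.subspace_scale[OF subspace_W]) (auto simp: V_iff)
    then show "(\<lambda>x. cscale c F (u, x)) \<in> rep_space \<sigma>" by (simp add: cscale_def)
    fix h assume h: "h \<in> H"
    then interpret L: Vector_Spaces.linear cscale cscale "rep_act \<sigma> (inv h)" by (intro lin) simp
    show "(\<lambda>x. cscale c F (u \<otimes> h, x)) = rep_act \<sigma> (inv h) (\<lambda>x. cscale c F (u, x))"
      using F u h L.scale[of c "\<lambda>x. F (u, x)"] by (simp add: V_iff cscale_def fun_eq_iff)
  qed (use F in \<open>auto simp: V_iff cscale_apply\<close>)
qed

lemma inv_mult_right:
  assumes "u \<in> carrier G" "h \<in> H" "c \<in> carrier G"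
  shows "inv (u \<otimes> h) \<otimes> c = inv h \<otimes> (inv u \<otimes> c)"
  using assms by (simp add: inv_mult_group m_assoc)

lemma H_cancel:
  assumes "h \<in> H" "g \<in> carrier G"
  shows "inv h \<otimes> g \<in> H \<longleftrightarrow> g \<in> H"
proof
  assume "inv h \<otimes> g \<in> H"
  then have "h \<otimes> (inv h \<otimes> g) \<in> H" using assms by simp
  then show "g \<in> H" using assms by (simp add: m_assoc[symmetric])
qed (use assms in simp)

lemma ind_fun_in_V:
  assumes c: "c \<in> U" and \<xi>: "\<xi> \<in> Y"
  shows "ind_fun (c, \<xi>) \<in> V"
  unfolding V_iff
proof (intro conjI ballI allI impI)
  have cG: "c \<in> carrier G" using c U by blast
  have e: "e \<xi> \<in> rep_space \<sigma>" by (rule lagrange_basisD(3)[OF basis \<xi>])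
  fix u assume u: "u \<in> carrier G"
  have z: "(\<lambda>_. 0) \<in> rep_space \<sigma>" using cfun.subspace_0[OF subspace_W] by (simp add: zero_fun_def)
  show "(\<lambda>x. ind_fun (c, \<xi>) (u, x)) \<in> rep_space \<sigma>"
    using u closed[OF _ e] z by (cases "inv u \<otimes> c \<in> H") (simp_all add: ind_fun_def)
  fix h assume h: "h \<in> H"
  have hG: "h \<in> carrier G" using h by simp
  show "(\<lambda>x. ind_fun (c, \<xi>) (u \<otimes> h, x)) = rep_act \<sigma> (inv h) (\<lambda>x. ind_fun (c, \<xi>) (u, x))"
  proof (cases "inv u \<otimes> c \<in> H")
    case True
    then show ?thesis using u h hG cG act_mult[of "inv h" "inv u \<otimes> c" "e \<xi>"] e
      by (simp add: ind_fun_def inv_mult_right[OF u h cG])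
  next
    case False
    then show ?thesis using u h hG cG
      by (simp add: ind_fun_def inv_mult_right[OF u h cG] H_cancel act_zero)
  qed
qed (simp add: ind_fun_def)

text \<open>Equivariance determines a function of \<open>V\<close> by its values on the transversal,
  and each of these values is a vector of \<open>rep_space \<sigma>\<close> that can be expanded in
  the basis \<open>e\<close>.\<close>

lemma lagrange_induced: "lagrange_basis V (U \<times> Y) ind_fun"
proof (rule lagrange_basisI)
  note D = lagrange_basisD[OF basis]
  show "cfun.subspace V" by (rule subspace_V)
  show "finite (U \<times> Y)" using U D(2) by simp
  show "ind_fun p \<in> V" if "p \<in> U \<times> Y" for p using that ind_fun_in_V by (cases p) auto
  show "ind_fun p q = (if p = q then 1 else 0)" if pq: "p \<in> U \<times> Y" "q \<in> U \<times> Y" for p q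
  proof -
    obtain c \<xi> c' \<xi>' where [simp]: "p = (c, \<xi>)" "q = (c', \<xi>')" by (cases p, cases q)
    have *: "c \<in> U" "\<xi> \<in> Y" "c' \<in> U" "\<xi>' \<in> Y" using pq by auto
    then have G: "c \<in> carrier G" "c' \<in> carrier G" using U by auto
    show ?thesis
    proof (cases "c = c'")
      case True
      then show ?thesis using * G by (simp add: ind_fun_def act_one D(3,4))
    next
      case False
      then have "inv c' \<otimes> c \<notin> H" using U_unique[of c' c] * by blast
      then show ?thesis using False by (simp add: ind_fun_def)
    qed
  qed
  fix F :: "'g \<times> 'x \<Rightarrow> complex" and z :: "'g \<times> 'x" assume F: "F \<in> V"
  obtain u x where [simp]: "z = (u, x)" by (cases z)
  show "F z = (\<Sum>p\<in>U \<times> Y. F p * ind_fun p z)"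
  proof (cases "u \<in> carrier G")
    case False
    then show ?thesis using F by (simp add: V_iff ind_fun_def split_beta)
  next
    case u: True
    obtain c where c: "c \<in> U" "inv u \<otimes> c \<in> H" using U_ex[OF u] by blast
    have cG: "c \<in> carrier G" using c U by blast
    let ?h = "inv u \<otimes> c"
    have Fc: "(\<lambda>\<xi>. F (c, \<xi>)) \<in> rep_space \<sigma>" using F cG by (simp add: V_iff)
    \<comment> \<open>Writing \<open>u\<close> as the representative \<open>c\<close> times an
      element of \<open>H\<close> lets equivariance compute \<open>F\<close> at \<open>u\<close>
      from its value at \<open>c\<close>.\<close>
    have uc: "c \<otimes> inv ?h = u" using cG u by (simp add: inv_mult_group m_assoc[symmetric])
    have "(\<lambda>x. F (c \<otimes> inv ?h, x)) = rep_act \<sigma> (inv (inv ?h)) (\<lambda>x. F (c, x))"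
      using F cG c(2) unfolding V_iff by blast
    then have "F (u, x) = rep_act \<sigma> ?h (\<lambda>\<xi>. F (c, \<xi>)) x"
      unfolding uc using cG u by (simp add: fun_eq_iff)
    also have "\<dots> = rep_act \<sigma> ?h (\<Sum>\<xi>\<in>Y. cscale (F (c, \<xi>)) (e \<xi>)) x"
      using D(5)[OF Fc] by simp
    also have "\<dots> = (\<Sum>\<xi>\<in>Y. F (c, \<xi>) * ind_fun (c, \<xi>) (u, x))"
      using u c by (simp add: linear_apply_sum[OF lin] ind_fun_def)
    \<comment> \<open>The sum may run over all of \<open>U\<close>, because the functions attached
      to other cosets vanish at \<open>u\<close>.\<close>
    also have "\<dots> = (\<Sum>c'\<in>U. if c' = c then \<Sum>\<xi>\<in>Y. F (c', \<xi>) * ind_fun (c', \<xi>) (u, x) else 0)"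
      using c U by simp
    also have "\<dots> = (\<Sum>c'\<in>U. \<Sum>\<xi>\<in>Y. F (c', \<xi>) * ind_fun (c', \<xi>) (u, x))"
    proof (rule sum.cong[OF refl])
      fix c' assume c': "c' \<in> U"
      then have c'G: "c' \<in> carrier G" using U by blast
      have "inv c \<otimes> c' \<in> H" if "inv u \<otimes> c' \<in> H"
      proof -
        have "inv ?h \<otimes> (inv u \<otimes> c') \<in> H" using that c by simp
        also have "inv ?h \<otimes> (inv u \<otimes> c') = inv c \<otimes> c'"
          using u cG c'G by (simp add: inv_mult_group m_assoc) (simp add: m_assoc[symmetric])
        finally show ?thesis .
      qed
      then have "inv u \<otimes> c' \<notin> H" if "c' \<noteq> c" using U_unique[of c c'] c c' that by blast
      then show "(if c' = c then \<Sum>\<xi>\<in>Y. F (c', \<xi>) * ind_fun (c', \<xi>) (u, x) else 0)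
          = (\<Sum>\<xi>\<in>Y. F (c', \<xi>) * ind_fun (c', \<xi>) (u, x))"
        by (cases "c' = c") (simp_all add: ind_fun_def)
    qed
    also have "\<dots> = (\<Sum>p\<in>U \<times> Y. F p * ind_fun p z)" by (simp add: sum.cartesian_product split_beta)
    finally show ?thesis by simp
  qed
qed

lemma act_linear: "Vector_Spaces.linear cscale cscale (act g)"
  by (rule linearI_cscale) (auto simp: act_apply fun_eq_iff cscale_apply)

lemma act_closed:
  assumes g: "g \<in> carrier G" and F: "F \<in> V"
  shows "act g F \<in> V"
  unfolding V_iff using g F by (simp add: act_apply V_iff m_assoc[symmetric])

lemma act_mult_induced:
  assumes "g \<in> carrier G" "g' \<in> carrier G"
  shows "act (g \<otimes> g') F = act g (act g' F)"
  using assms by (auto simp: fun_eq_iff act_apply inv_mult_group m_assoc)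

lemma act_one_induced:
  assumes "F \<in> V"
  shows "act \<one> F = F"
  using assms by (auto simp: fun_eq_iff act_apply V_iff)

text \<open>The matrix of \<open>g\<close> is block monomial: the block from \<open>c\<close> to
  \<open>c'\<close> vanishes unless \<open>g \<otimes> c\<close> lies in the coset of
  \<open>c'\<close>. With \<open>c' = c\<close> and summation over the basis this is the formula for
  the induced character.\<close>

lemma act_ind_fun:
  assumes g: "g \<in> carrier G" and c: "c \<in> U" "c' \<in> U"
  shows "act g (ind_fun (c, \<xi>)) (c', \<xi>') =
    (if inv c' \<otimes> g \<otimes> c \<in> H then rep_act \<sigma> (inv c' \<otimes> g \<otimes> c) (e \<xi>) \<xi>' else 0)"
proof -
  have "c \<in> carrier G" "c' \<in> carrier G" using c U by auto
  then show ?thesis using g by (simp add: act_apply ind_fun_def inv_mult_group)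
qed

end

section \<open>Counting colourings\<close>

definition colourings :: "'a set \<Rightarrow> nat \<Rightarrow> (nat \<Rightarrow> nat) \<Rightarrow> ('a \<Rightarrow> nat) set" where
  "colourings A r a = {c \<in> A \<rightarrow>\<^sub>E {..<r}. \<forall>k<r. card {i \<in> A. c i = k} = a k}"

lemma finite_colourings: "finite A \<Longrightarrow> finite (colourings A r a)"
  unfolding colourings_def by (rule finite_subset[of _ "A \<rightarrow>\<^sub>E {..<r}"]) (auto intro!: finite_PiE)

lemma fun_upd_in_colourings:
  assumes A: "finite A" "x \<notin> A" and k: "k < r" "a k > 0" and c: "c \<in> colourings A r (a(k := a k - 1))"
  shows "c(x := k) \<in> colourings (insert x A) r a"
  unfolding colourings_def
proof (intro CollectI conjI allI impI)
  show "c(x := k) \<in> insert x A \<rightarrow>\<^sub>E {..<r}"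
    using c k(1) A(2) by (auto simp: colourings_def PiE_iff extensional_def)
  fix j assume j: "j < r"
  have "{i \<in> insert x A. (c(x := k)) i = j} = (if j = k then insert x {i \<in> A. c i = j} else {i \<in> A. c i = j})"
    using A(2) by auto
  then show "card {i \<in> insert x A. (c(x := k)) i = j} = a j"
    using c j k A by (auto simp: colourings_def)
qed

lemma restrict_in_colourings:
  assumes A: "finite A" "x \<notin> A" and c: "c \<in> colourings (insert x A) r a" and k: "c x = k"
  shows "a k > 0" "restrict c A \<in> colourings A r (a(k := a k - 1))"
proof -
  have kr: "k < r" using c k by (auto simp: colourings_def PiE_iff)
  have card: "a j = card {i \<in> A. c i = j} + (if j = k then 1 else 0)" if "j < r" for j
  proof -
    have "{i \<in> insert x A. c i = j} = (if j = k then insert x {i \<in> A. c i = j} else {i \<in> A. c i = j})"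
      using k by auto
    then show ?thesis using c that A by (auto simp: colourings_def split: if_splits)
  qed
  show "a k > 0" using card[OF kr] by simp
  have "{i \<in> A. restrict c A i = j} = {i \<in> A. c i = j}" for j by auto
  then show "restrict c A \<in> colourings A r (a(k := a k - 1))"
    using c card by (auto simp: colourings_def PiE_iff)
qed

text \<open>Forgetting the value at \<open>x\<close> is a bijection with inverse
  \<open>c(x := k)\<close>. The predicates \<open>P\<close> and \<open>Q\<close> carry a condition
  on the remaining points, so that a second value can be prescribed afterwards. The truncated
  \<open>a k - 1\<close> is meaningful only for positive \<open>a k\<close>, hence the case
  distinction.\<close>

lemma card_colourings_fixed:
  assumes A: "finite A" "x \<notin> A" and k: "k < r"
    and P: "\<And>c. P c \<longleftrightarrow> Q (restrict c A)"
  shows "card {c \<in> colourings (insert x A) r a. c x = k \<and> P c} =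
    (if a k > 0 then card {c \<in> colourings A r (a(k := a k - 1)). Q c} else 0)"
proof (cases "a k > 0")
  case True
  have "bij_betw (\<lambda>c. restrict c A) {c \<in> colourings (insert x A) r a. c x = k \<and> P c}
      {c \<in> colourings A r (a(k := a k - 1)). Q c}"
  proof (rule bij_betw_byWitness[where f' = "\<lambda>c. c(x := k)"])
    show "\<forall>c\<in>{c \<in> colourings (insert x A) r a. c x = k \<and> P c}. (restrict c A)(x := k) = c"
      by (auto simp: fun_eq_iff colourings_def PiE_iff extensional_def)
    show "\<forall>c\<in>{c \<in> colourings A r (a(k := a k - 1)). Q c}. restrict (c(x := k)) A = c"
      using A by (auto simp: fun_eq_iff colourings_def PiE_iff extensional_def)
    show "(\<lambda>c. restrict c A) ` {c \<in> colourings (insert x A) r a. c x = k \<and> P c}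
        \<subseteq> {c \<in> colourings A r (a(k := a k - 1)). Q c}"
      using restrict_in_colourings[OF A] P by auto
    show "(\<lambda>c. c(x := k)) ` {c \<in> colourings A r (a(k := a k - 1)). Q c}
        \<subseteq> {c \<in> colourings (insert x A) r a. c x = k \<and> P c}"
    proof (rule image_subsetI)
      fix c assume c: "c \<in> {c \<in> colourings A r (a(k := a k - 1)). Q c}"
      have "c \<in> extensional A" using c by (auto simp: colourings_def PiE_iff)
      then have "restrict (c(x := k)) A = c"
        using A by (auto simp: fun_eq_iff restrict_def extensional_def)
      then show "c(x := k) \<in> {c \<in> colourings (insert x A) r a. c x = k \<and> P c}"
        using fun_upd_in_colourings[where a = a and k = k, OF A k True] c P by auto
    qed
  qed
  then show ?thesis using True bij_betw_same_card by auto
next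
  case False
  then have "{c \<in> colourings (insert x A) r a. c x = k \<and> P c} = {}"
    using restrict_in_colourings(1)[OF A, where a = a and k = k] by auto
  then show ?thesis using False by (simp only: card.empty if_False)
qed

lemma card_colourings_by_value:
  assumes "finite A" "x \<in> A"
  shows "card (colourings A r a) = (\<Sum>k<r. card {c \<in> colourings A r a. c x = k})"
proof -
  have "card (\<Union>k<r. {c \<in> colourings A r a. c x = k}) = (\<Sum>k<r. card {c \<in> colourings A r a. c x = k})"
    using finite_colourings[OF assms(1)] by (intro card_UN_disjoint) auto
  also have "(\<Union>k<r. {c \<in> colourings A r a. c x = k}) = colourings A r a"
    using assms(2) by (auto simp: colourings_def)
  finally show ?thesis .
qed

lemma sum_fun_upd_pred:
  fixes a :: "nat \<Rightarrow> nat"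
  assumes "k < r" "d \<le> a k"
  shows "(\<Sum>j<r. (a(k := a k - d)) j) + d = (\<Sum>j<r. a j)"
proof -
  have "(\<Sum>j<r. (a(k := a k - d)) j) = (a k - d) + (\<Sum>j\<in>{..<r} - {k}. a j)"
    using assms by (subst sum.remove[of _ k]) auto
  moreover have "(\<Sum>j<r. a j) = a k + (\<Sum>j\<in>{..<r} - {k}. a j)"
    using assms by (subst sum.remove[of _ k]) auto
  ultimately show ?thesis using assms by simp
qed

lemma prod_fact_fun_upd_pred:
  fixes a :: "nat \<Rightarrow> nat"
  assumes "k < r" "a k > 0"
  shows "(\<Prod>j<r. fact (a j) :: nat) = a k * (\<Prod>j<r. fact ((a(k := a k - 1)) j))"
proof -
  have "(\<Prod>j<r. fact ((a(k := a k - 1)) j) :: nat) = fact (a k - 1) * (\<Prod>j\<in>{..<r} - {k}. fact (a j))"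
    using assms by (subst prod.remove[of _ k]) auto
  moreover have "(\<Prod>j<r. fact (a j) :: nat) = fact (a k) * (\<Prod>j\<in>{..<r} - {k}. fact (a j))"
    using assms by (subst prod.remove[of _ k]) auto
  moreover have "(fact (a k) :: nat) = a k * fact (a k - 1)" using assms by (cases "a k") auto
  ultimately show ?thesis by simp
qed

text \<open>The multinomial coefficient, cleared of its denominator. Deleting a point
  \<open>x\<close> of colour \<open>k\<close> lowers \<open>a k\<close> by one, so the colourings
  with \<open>c x = k\<close> contribute \<open>a k * fact (card A)\<close>, and the numbers
  \<open>a k\<close> add up to the size of the enlarged set.\<close>

lemma card_colourings:
  fixes A :: "'a set"
  assumes "finite A" "(\<Sum>k<r. a k) = card A"
  shows "card (colourings A r a) * (\<Prod>k<r. fact (a k)) = fact (card A)"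
  using assms
proof (induction A arbitrary: a rule: finite_induct)
  case empty
  then have "a k = 0" if "k < r" for k using that by simp
  moreover from this have "colourings ({} :: 'a set) r a = {\<lambda>_. undefined}" by (auto simp: colourings_def)
  ultimately show ?case by simp
next
  case (insert x A)
  let ?P = "\<Prod>k<r. fact (a k) :: nat"
  have step: "card {c \<in> colourings (insert x A) r a. c x = k} * ?P = a k * fact (card A)" if k: "k < r" for k
  proof (cases "a k > 0")
    case True
    define b where "b = a(k := a k - 1)"
    have "(\<Sum>j<r. b j) = card A"
      using sum_fun_upd_pred[OF k, of 1 a] True insert.prems insert.hyps by (simp add: b_def)
    note IH = insert.IH[OF this]
    have "card {c \<in> colourings (insert x A) r a. c x = k} = card (colourings A r b)"
      using card_colourings_fixed[OF insert.hyps k, of "\<lambda>_. True" "\<lambda>_. True" a] True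
      unfolding b_def[symmetric] by simp
    moreover have "?P = a k * (\<Prod>j<r. fact (b j))"
      unfolding b_def by (rule prod_fact_fun_upd_pred[where a = a, OF k True])
    ultimately show ?thesis using IH by (simp add: mult.left_commute)
  next
    case False
    then show ?thesis
      using card_colourings_fixed[OF insert.hyps k, of "\<lambda>_. True" "\<lambda>_. True" a] by simp
  qed
  have "card (colourings (insert x A) r a) * ?P = (\<Sum>k<r. a k * fact (card A))"
    using card_colourings_by_value[of "insert x A" x r a] insert.hyps step by (simp add: sum_distrib_right)
  also have "\<dots> = fact (card (insert x A))"
    using insert.hyps insert.prems by (simp add: sum_distrib_right[symmetric])
  finally show ?case .
qed

lemma card_colourings_fixed1:
  assumes A: "finite A" "x \<in> A" and k: "k < r" and a: "(\<Sum>k<r. a k) = card A"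
  shows "card {c \<in> colourings A r a. c x = k} =
    (if a k < 1 then 0 else fact (card A - 1) div (\<Prod>j<r. fact ((a(k := a k - 1)) j)))"
proof -
  have ins: "insert x (A - {x}) = A" using A by auto
  have f: "finite (A - {x})" "x \<notin> A - {x}" using A by auto
  show ?thesis
  proof (cases "a k > 0")
    case True
    have "(\<Sum>j<r. (a(k := a k - 1)) j) = card (A - {x})"
      using sum_fun_upd_pred[OF k, of 1 a] True a A by simp
    from card_colourings[OF f(1) this]
    have "card (colourings (A - {x}) r (a(k := a k - 1))) =
        fact (card (A - {x})) div (\<Prod>j<r. fact ((a(k := a k - 1)) j))"
      by (metis div_mult_self_is_m fact_gt_zero prod_pos)
    then show ?thesis
      using card_colourings_fixed[OF f k, of "\<lambda>_. True" "\<lambda>_. True" a] True A unfolding ins by simp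
  next
    case False
    then show ?thesis
      using card_colourings_fixed[OF f k, of "\<lambda>_. True" "\<lambda>_. True" a] unfolding ins by simp
  qed
qed

text \<open>Deleting \<open>x\<close> turns the problem into that of one prescribed value with
  \<open>a k\<close> lowered by one; a colour with \<open>a k = 1\<close> is then excluded at the
  second point.\<close>

lemma card_colourings_fixed2:
  assumes A: "finite A" "x \<in> A" "y \<in> A" "x \<noteq> y" and k: "k < r" and a: "(\<Sum>k<r. a k) = card A"
  shows "card {c \<in> colourings A r a. c x = k \<and> c y = k} =
    (if a k < 2 then 0 else fact (card A - 2) div (\<Prod>j<r. fact ((a(k := a k - 2)) j)))"
proof -
  have ins: "insert x (A - {x}) = A" using A by auto
  have f: "finite (A - {x})" "x \<notin> A - {x}" "y \<in> A - {x}" using A by auto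
  have fix1: "card {c \<in> colourings A r a. c x = k \<and> c y = k} =
      (if a k > 0 then card {c \<in> colourings (A - {x}) r (a(k := a k - 1)). c y = k} else 0)"
    by (rule card_colourings_fixed[where P = "\<lambda>c. c y = k" and Q = "\<lambda>c. c y = k" and a = a,
          OF f(1,2) k, unfolded ins]) (use f(3) in simp)
  show ?thesis
  proof (cases "a k > 0")
    case True
    have s: "(\<Sum>j<r. (a(k := a k - 1)) j) = card (A - {x})"
      using sum_fun_upd_pred[OF k, of 1 a] True a A by simp
    have upd: "(a(k := a k - 1))(k := (a(k := a k - 1)) k - 1) = a(k := a k - 2)" by (simp add: numeral_2_eq_2)
    have c: "card (A - {x}) - 1 = card A - 2" using A by simp
    have cond: "(a(k := a k - 1)) k < 1 \<longleftrightarrow> a k < 2" using True by auto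
    show ?thesis
      unfolding fix1 if_P[OF True]
      by (rule card_colourings_fixed1[OF f(1,3) k s, unfolded upd c cond])
  qed (use fix1 in simp)
qed

section \<open>Specht modules\<close>

lemma tabloid_in_PiE:
  assumes "t \<in> tableaux \<mu>"
  shows "tabloid \<mu> t \<in> {1..sum_list \<mu>} \<rightarrow>\<^sub>E {..<length \<mu>}"
proof (rule PiE_I)
  fix v assume v: "v \<in> {1..sum_list \<mu>}"
  have "t ` cells \<mu> = {1..sum_list \<mu>}" using assms by (simp add: tableaux_def bij_betw_def)
  then have "inv_into (cells \<mu>) t v \<in> cells \<mu>" using v by (intro inv_into_into) simp
  then show "tabloid \<mu> t v \<in> {..<length \<mu>}" using v by (auto simp: tabloid_def cells_def)
qed (simp only: tabloid_def restrict_apply if_False)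

text \<open>Tabloids are extensional functions into the finite set of row indices. The Specht module
  therefore lives on a finite set of points, as \<open>lagrange_basis_exists\<close>
  requires.\<close>

lemma polytabloid_support:
  assumes t: "t \<in> tableaux \<mu>" and T: "T \<notin> {1..sum_list \<mu>} \<rightarrow>\<^sub>E {..<length \<mu>}"
  shows "polytabloid \<mu> t T = 0"
proof -
  have "T \<noteq> tabloid \<mu> (\<sigma> \<circ> t)" if "\<sigma> \<in> column_stabilizer \<mu> t" for \<sigma>
  proof -
    have "\<sigma> permutes {1..sum_list \<mu>}" using that by (simp add: column_stabilizer_def)
    from tabloid_in_PiE[OF specht_act_polytabloid(1)[OF this t]] T show ?thesis by blast
  qed
  then show ?thesis by (simp add: polytabloid_def)
qed

lemma specht_lagrange_exists: "\<exists>X f. lagrange_basis (rep_space (specht \<mu>)) X f"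
proof -
  let ?S = "{1..sum_list \<mu>} \<rightarrow>\<^sub>E {..<length \<mu>}"
  have sub: "cfun.subspace {v. \<forall>T. T \<notin> ?S \<longrightarrow> v T = 0}"
    by (rule cfun.subspaceI) (auto simp: cscale_apply)
  have "rep_space (specht \<mu>) \<subseteq> {v. \<forall>T. T \<notin> ?S \<longrightarrow> v T = 0}"
    unfolding specht_def rep.simps
  proof (rule cfun.span_minimal[OF _ sub], rule image_subsetI)
    fix t assume "t \<in> tableaux \<mu>"
    from polytabloid_support[OF this] show "polytabloid \<mu> t \<in> {v. \<forall>T. T \<notin> ?S \<longrightarrow> v T = 0}"
      by (intro CollectI allI impI)
  qed
  then have van: "\<And>v T. v \<in> rep_space (specht \<mu>) \<Longrightarrow> T \<notin> ?S \<Longrightarrow> v T = 0" by (auto simp only:)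
  have sp: "cfun.subspace (rep_space (specht \<mu>))" by (simp add: specht_def cfun.subspace_span)
  have "finite ?S" by (intro finite_PiE) auto
  then have "\<exists>X f. X \<subseteq> ?S \<and> lagrange_basis (rep_space (specht \<mu>)) X f"
    using sp by (rule lagrange_basis_exists) (rule van)
  then show ?thesis by blast
qed

lemma specht_act: "rep_act (specht \<mu>) w f = (\<lambda>T. f (T \<circ> w))"
  by (simp add: specht_def)

lemma specht_act_linear: "Vector_Spaces.linear cscale cscale (rep_act (specht \<mu>) w)"
  by (rule linearI_cscale) (auto simp: specht_act fun_eq_iff cscale_apply)

lemma specht_act_closed:
  assumes w: "w permutes {1..sum_list \<mu>}" and f: "f \<in> rep_space (specht \<mu>)"
  shows "rep_act (specht \<mu>) w f \<in> rep_space (specht \<mu>)"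
proof -
  have "rep_act (specht \<mu>) w f \<in> cfun.span (polytabloid \<mu> ` tableaux \<mu>)"
  proof (rule linear_image_cspan[OF specht_act_linear])
    show "f \<in> cfun.span (polytabloid \<mu> ` tableaux \<mu>)" using f by (simp add: specht_def)
    show "rep_act (specht \<mu>) w x \<in> cfun.span (polytabloid \<mu> ` tableaux \<mu>)"
      if "x \<in> polytabloid \<mu> ` tableaux \<mu>" for x
      using that specht_act_polytabloid[OF w] by (auto intro!: cfun.span_base)
  qed
  then show ?thesis by (simp add: specht_def)
qed

lemma specht_char_id: "rep_char (specht \<mu>) id = of_nat (f_dim \<mu>)"
proof -
  obtain X f where L: "lagrange_basis (rep_space (specht \<mu>)) X f" using specht_lagrange_exists by blast
  have "rep_char (specht \<mu>) id = (\<Sum>p\<in>X. f p p)"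
    unfolding rep_char_def by (subst trace_on_lagrange[OF L specht_act_linear specht_act_closed[OF permutes_id]])
      (auto simp: specht_act)
  also have "\<dots> = of_nat (card X)" using lagrange_basisD(4)[OF L] by simp
  finally show ?thesis by (simp add: f_dim_def rep_dim_def lagrange_dim[OF L])
qed

lemma specht_char_conj:
  assumes w: "w permutes {1..sum_list \<mu>}" and v: "v permutes {1..sum_list \<mu>}"
  shows "rep_char (specht \<mu>) (w \<circ> v \<circ> inv' w) = rep_char (specht \<mu>) v"
proof -
  obtain X f where L: "lagrange_basis (rep_space (specht \<mu>)) X f" using specht_lagrange_exists by blast
  let ?a = "rep_act (specht \<mu>)"
  have iw: "inv' w permutes {1..sum_list \<mu>}" by (rule permutes_inv[OF w])
  have vw: "v \<circ> inv' w permutes {1..sum_list \<mu>}" by (rule permutes_compose[OF iw v])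
  have "?a (w \<circ> v \<circ> inv' w) = (\<lambda>f. ?a w (?a (v \<circ> inv' w) f))"
    by (rule ext) (simp add: specht_act o_assoc)
  then have "rep_char (specht \<mu>) (w \<circ> v \<circ> inv' w)
      = trace_on (rep_space (specht \<mu>)) (\<lambda>f. ?a w (?a (v \<circ> inv' w) f))"
    by (simp add: rep_char_def)
  also have "\<dots> = trace_on (rep_space (specht \<mu>)) (\<lambda>f. ?a (v \<circ> inv' w) (?a w f))"
    by (rule trace_on_comm[OF L specht_act_linear specht_act_closed[OF w] specht_act_linear specht_act_closed[OF vw]])
  also have "(\<lambda>f. ?a (v \<circ> inv' w) (?a w f)) = ?a v"
    using permutes_inv_o(2)[OF w] by (intro ext) (simp add: specht_act o_assoc[symmetric])
  finally show ?thesis unfolding rep_char_def .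
qed

lemma comp_transpose_inv:
  assumes "bij w"
  shows "w \<circ> Transposition.transpose p q \<circ> inv' w = Transposition.transpose (w p) (w q)"
proof
  fix x
  have inj: "w a = w b \<longleftrightarrow> a = b" for a b using assms by (simp add: bij_def inj_eq)
  obtain y where y: "x = w y" using assms by (metis bij_pointE)
  have "inv' w x = y" using assms y by (simp add: bij_is_inj)
  then show "(w \<circ> Transposition.transpose p q \<circ> inv' w) x = Transposition.transpose (w p) (w q) x"
    by (simp add: Transposition.transpose_def y inj)
qed

text \<open>Transpositions are conjugate and the character is a class function;
  \<open>g_mult\<close> refers only to the transposition of 1 and 2.\<close>

lemma specht_char_transpose:
  assumes pq: "p \<in> {1..sum_list \<mu>}" "q \<in> {1..sum_list \<mu>}" "p \<noteq> q"
  shows "rep_char (specht \<mu>) (Transposition.transpose p q) = rep_char (specht \<mu>) (Transposition.transpose 1 2)"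
proof -
  let ?A = "{1..sum_list \<mu>}"
  have 12: "1 \<in> ?A" "2 \<in> ?A" using pq by auto
  define u where "u = Transposition.transpose 1 p"
  have u: "u permutes ?A" unfolding u_def by (rule permutes_swap_id[OF 12(1) pq(1)])
  have u1: "u 1 = p" by (simp add: u_def)
  have u2: "u 2 \<noteq> p" "u 2 \<in> ?A" using permutes_inj[OF u] u1 permutes_in_image[OF u] 12 by (metis injD numeral_eq_one_iff one_eq_numeral_iff semiring_norm(85), blast)
  \<comment> \<open>The permutation \<open>u\<close> already sends 1 to \<open>p\<close>. Swapping
    \<open>u 2\<close> with \<open>q\<close> brings the image of 2 to \<open>q\<close> and leaves
    \<open>p\<close> in place, since \<open>p\<close> differs from both.\<close>
  define w where "w = Transposition.transpose (u 2) q \<circ> u"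
  have w: "w permutes ?A" unfolding w_def by (rule permutes_compose[OF u permutes_swap_id[OF u2(2) pq(2)]])
  have w12: "w 1 = p" "w 2 = q" using u1 u2 pq by (auto simp: w_def)
  have "Transposition.transpose p q = w \<circ> Transposition.transpose 1 2 \<circ> inv' w"
    using comp_transpose_inv[OF permutes_bij[OF w], of 1 2] w12 by simp
  then show ?thesis using specht_char_conj[OF w permutes_swap_id[OF 12]] by simp
qed

text \<open>Coordinates of group elements are integers reduced modulo \<open>r\<close> after each
  multiplication; this lets the reduction be ignored in exponents of a root of unity.\<close>

lemma powi_cong:
  fixes z :: complex
  assumes "z \<noteq> 0" "z ^ r = 1" "a mod int r = b mod int r"
  shows "z powi a = z powi b"
proof -
  obtain k where k: "a = b + int r * k" using assms(3) by (metis mod_eqE)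
  have "z powi (b + int r * k) = z powi b * (z powi int r) powi k"
    using assms(1) by (simp add: power_int_add power_int_mult)
  then show ?thesis using k assms(2) by simp
qed

lemma powi_sum:
  fixes z :: complex
  assumes "z \<noteq> 0"
  shows "z powi (\<Sum>i\<in>A. f i) = (\<Prod>i\<in>A. z powi f i)"
  by (induction A rule: infinite_finite_induct) (auto simp: power_int_add assms)

section \<open>Cosets of the Young subgroup\<close>

text \<open>The index of the block containing \<open>i\<close>. For positive \<open>i\<close>,
  taking the least index passes over empty blocks, since an empty block has the same upper end as
  its predecessor.\<close>

definition colour :: "nat list list \<Rightarrow> nat \<Rightarrow> nat" where
  "colour lam i = (LEAST k. i \<le> block_offset lam (Suc k))"

lemma block_offset_Suc: "block_offset lam (Suc k) = block_offset lam k + part_size lam k"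
  by (simp add: block_offset_def)

lemma block_offset_mono: "j \<le> k \<Longrightarrow> block_offset lam j \<le> block_offset lam k"
  unfolding block_offset_def by (rule sum_mono2) auto

lemma block_iff: "i \<in> block lam k \<longleftrightarrow> block_offset lam k < i \<and> i \<le> block_offset lam (Suc k)"
  by (auto simp: block_def block_offset_Suc)

lemma colour_eq:
  assumes "i \<in> block lam k"
  shows "colour lam i = k"
  unfolding colour_def
proof (rule Least_equality)
  show "i \<le> block_offset lam (Suc k)" using assms by (simp add: block_iff)
  fix j assume "i \<le> block_offset lam (Suc j)"
  then show "k \<le> j" using assms block_offset_mono[of "Suc j" k lam] by (force simp: block_iff not_le)
qed

locale wreath_rep =
  fixes n r :: nat and \<zeta> :: complex and lam :: "nat list list"
  assumes r: "r > 0" and zeta: "\<zeta> ^ r = 1" and lam: "lam \<in> multipartitions n r"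
begin

abbreviation "G \<equiv> wreath_group n r"
abbreviation "H \<equiv> young_subgroup n r lam"
abbreviation "a \<equiv> part_size lam"
abbreviation "off \<equiv> block_offset lam"
definition N :: "nat set" where "N = {1..n}"

sublocale group G by (rule group_wreath_group)

lemma finite_N [simp]: "finite N" and card_N [simp]: "card N = n"
  by (simp_all add: N_def)

lemma zeta_nz: "\<zeta> \<noteq> 0"
  using zeta r by (auto simp: power_0_left)

lemma sum_a: "(\<Sum>k<r. a k) = n"
proof -
  have "n = sum_list (map sum_list lam)" "length lam = r" using lam by (auto simp: multipartitions_def)
  then show ?thesis by (simp add: sum_list_sum_nth part_size_def atLeast0LessThan)
qed

lemma off_r: "off r = n"
  using sum_a by (simp add: block_offset_def)

lemma block_subset: "k < r \<Longrightarrow> block lam k \<subseteq> N"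
  using block_offset_mono[of "Suc k" r lam] by (auto simp: block_iff off_r N_def)

lemma colour_block:
  assumes "i \<in> N"
  shows "colour lam i < r" "i \<in> block lam (colour lam i)"
proof -
  let ?P = "\<lambda>k. i \<le> off (Suc k)"
  have P: "?P (r - 1)" using r assms off_r by (simp add: N_def)
  have "?P (colour lam i)" unfolding colour_def by (rule LeastI[of ?P, OF P])
  moreover have "colour lam i \<le> r - 1" unfolding colour_def by (rule Least_le[of ?P, OF P])
  moreover have "off (colour lam i) < i"
  proof (cases "colour lam i")
    case 0
    then show ?thesis using assms by (simp add: block_offset_def N_def)
  next
    case (Suc k)
    then have "\<not> ?P k" unfolding colour_def using not_less_Least[of k ?P] by simp
    then show ?thesis using Suc by simp
  qed
  ultimately show "colour lam i < r" "i \<in> block lam (colour lam i)" using r by (auto simp: block_iff)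
qed

lemma block_eq: "k < r \<Longrightarrow> block lam k = {i \<in> N. colour lam i = k}"
  using block_subset colour_block(2) colour_eq by blast

lemma sum_over_blocks: "(\<Sum>k<r. \<Sum>i\<in>block lam k. f k i) = (\<Sum>i\<in>N. f (colour lam i) i :: int)"
proof -
  have "(\<Sum>i\<in>N. f (colour lam i) i) = (\<Sum>k<r. \<Sum>i\<in>{i \<in> N. colour lam i = k}. f (colour lam i) i)"
    by (rule sum.group[symmetric]) (use colour_block in auto)
  also have "\<dots> = (\<Sum>k<r. \<Sum>i\<in>block lam k. f k i)"
    by (intro sum.cong) (auto simp: block_eq)
  finally show ?thesis by simp
qed

lemma bij_off: "bij_betw (\<lambda>i. off k + i) {1..a k} (block lam k)"
proof -
  have "(\<lambda>i. off k + i) ` {1..a k} = block lam k"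
    unfolding block_def by (simp add: image_add_atLeastAtMost add.commute)
  then show ?thesis by (simp add: bij_betw_def inj_on_def)
qed

lemma bij_off': "bij_betw (\<lambda>i. i - off k) (block lam k) {1..a k}"
  by (rule bij_betw_byWitness[where f' = "\<lambda>i. off k + i"]) (auto simp: block_def)

lemma carrier_iff: "(x, w) \<in> carrier G \<longleftrightarrow> x \<in> N \<rightarrow>\<^sub>E {0..<int r} \<and> w permutes N"
  using r by (simp add: wreath_group_def Let_def carrier_integer_mod_group sym_group_def N_def)

lemma mult_eq: "(x, w) \<otimes>\<^bsub>G\<^esub> (y, v) = ((\<lambda>i\<in>N. (x i + y (inv' w i)) mod int r), w \<circ> v)"
  by (simp add: wreath_group_def Let_def sym_group_def N_def)

definition vec0 :: "nat \<Rightarrow> int" where "vec0 = (\<lambda>i\<in>N. 0)"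

lemma one_eq: "\<one>\<^bsub>G\<^esub> = (vec0, id)"
  by (simp add: wreath_group_def Let_def sym_group_def vec0_def N_def)

lemma vec0_carrier: "w permutes N \<Longrightarrow> (vec0, w) \<in> carrier G"
  using r by (simp add: carrier_iff vec0_def)

lemma snd_mult: "snd (g \<otimes>\<^bsub>G\<^esub> h) = snd g \<circ> snd h"
  by (cases g, cases h) (simp add: mult_eq)

lemma snd_permutes: "g \<in> carrier G \<Longrightarrow> snd g permutes N"
  by (cases g) (simp add: carrier_iff)

lemma snd_inv:
  assumes g: "g \<in> carrier G"
  shows "snd (inv\<^bsub>G\<^esub> g) = inv' (snd g)"
proof -
  have "snd g \<circ> snd (inv\<^bsub>G\<^esub> g) = id"
    using r_inv[OF g] by (metis one_eq snd_conv snd_mult)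
  moreover have "inv' (snd g) \<circ> snd g = id" using permutes_inv_o(2)[OF snd_permutes[OF g]] .
  ultimately show ?thesis by (metis comp_assoc comp_id id_comp)
qed

lemma permutes_inv_apply:
  assumes "w permutes N"
  shows "w (inv' w i) = i" "inv' w (w i) = i" "inv' w i \<in> N \<longleftrightarrow> i \<in> N" "w i \<in> N \<longleftrightarrow> i \<in> N"
  using permutes_inverses[OF assms] permutes_in_image[OF assms] permutes_in_image[OF permutes_inv[OF assms]]
  by blast+

text \<open>Blocks are the classes of equal colour. Preserving colours only gives that
  \<open>w\<close> maps each block into itself; equality follows because the blocks are finite and
  \<open>w\<close> is injective.\<close>

lemma young_iff: "h \<in> H \<longleftrightarrow> h \<in> carrier G \<and> (\<forall>i\<in>N. colour lam (snd h i) = colour lam i)"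
proof -
  obtain x w where [simp]: "h = (x, w)" by (cases h)
  have "(\<forall>k<r. w ` block lam k = block lam k) \<longleftrightarrow> (\<forall>i\<in>N. colour lam (w i) = colour lam i)"
    if w: "w permutes N"
  proof safe
    fix i assume *: "\<forall>k<r. w ` block lam k = block lam k" "i \<in> N"
    then have "w i \<in> block lam (colour lam i)" using colour_block[OF *(2)] by blast
    then show "colour lam (w i) = colour lam i" by (rule colour_eq)
  next
    assume *: "\<forall>i\<in>N. colour lam (w i) = colour lam i"
    have "w ` block lam k = block lam k" if k: "k < r" for k
    proof (rule card_subset_eq)
      show "finite (block lam k)" by (simp add: block_def)
      show "w ` block lam k \<subseteq> block lam k"
        using * permutes_in_image[OF w] by (auto simp: block_eq[OF k])
      show "card (w ` block lam k) = card (block lam k)"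
        using permutes_inj_on[OF w] by (rule card_image)
    qed
    then show "x \<in> w ` block lam k" "w y \<in> block lam k" if "k < r" "x \<in> block lam k" "y \<in> block lam k" for k x y
      using that by blast+
  qed
  then show ?thesis by (auto simp: young_subgroup_def carrier_iff)
qed

lemma subgroup_young: "subgroup H G"
proof (rule subgroupI)
  show "H \<subseteq> carrier G" by (auto simp: young_iff)
  have "\<one>\<^bsub>G\<^esub> \<in> H" by (simp add: young_iff one_eq vec0_carrier permutes_id)
  then show "H \<noteq> {}" by blast
  fix g assume g: "g \<in> H"
  then have gG: "g \<in> carrier G" by (simp add: young_iff)
  note p = permutes_inv_apply[OF snd_permutes[OF gG]]
  have "colour lam (inv' (snd g) i) = colour lam i" if "i \<in> N" for i
  proof -
    have "inv' (snd g) i \<in> N" using that p(3) by blast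
    then have "colour lam (snd g (inv' (snd g) i)) = colour lam (inv' (snd g) i)" using g young_iff by blast
    then show ?thesis by (simp add: p(1))
  qed
  then show "inv\<^bsub>G\<^esub> g \<in> H" using gG by (simp add: young_iff snd_inv)
  fix h assume h: "h \<in> H"
  then have hG: "h \<in> carrier G" by (simp add: young_iff)
  have "colour lam (snd g (snd h i)) = colour lam i" if "i \<in> N" for i
    using that g h permutes_inv_apply(4)[OF snd_permutes[OF hG]] by (auto simp: young_iff)
  then show "g \<otimes>\<^bsub>G\<^esub> h \<in> H" using gG hG by (simp add: young_iff snd_mult)
qed

abbreviation "Col \<equiv> colourings N r a"

text \<open>The coset of \<open>(x, w)\<close> is encoded by the colouring sending \<open>i\<close> to the block of \<open>inv' w i\<close>;
  \<open>perm_of c\<close> is a permutation inducing the colouring \<open>c\<close>.\<close>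

definition perm_of :: "(nat \<Rightarrow> nat) \<Rightarrow> nat \<Rightarrow> nat" where
  "perm_of c = (SOME w. w permutes N \<and> (\<forall>i\<in>N. c (w i) = colour lam i))"

text \<open>A colouring in \<open>Col\<close> uses every colour as often as
  \<open>colour lam\<close> does. The two multisets of values therefore coincide, which yields a
  permutation carrying one colouring to the other.\<close>

lemma perm_of:
  assumes c: "c \<in> Col"
  shows "perm_of c permutes N" "\<And>i. i \<in> N \<Longrightarrow> c (perm_of c i) = colour lam i"
    "\<And>i. i \<in> N \<Longrightarrow> colour lam (inv' (perm_of c) i) = c i"
proof -
  have "image_mset (colour lam) (mset_set N) = image_mset c (mset_set N)"
  proof (rule multiset_eqI)
    fix k
    have count: "count (image_mset f (mset_set N)) k = card {i \<in> N. f i = k}" for f :: "nat \<Rightarrow> nat"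
    proof -
      have "f -` {k} \<inter> N = {i \<in> N. f i = k}" by auto
      then show ?thesis by (simp add: count_image_mset)
    qed
    show "count (image_mset (colour lam) (mset_set N)) k = count (image_mset c (mset_set N)) k"
    proof (cases "k < r")
      case True
      have "card {i \<in> N. colour lam i = k} = a k"
        unfolding block_eq[OF True, symmetric] by (simp add: block_def)
      then show ?thesis using c True unfolding count by (simp add: colourings_def)
    next
      case False
      have "{i \<in> N. colour lam i = k} = {}" using False colour_block(1) by blast
      moreover have "{i \<in> N. c i = k} = {}" using False c by (auto simp: colourings_def PiE_iff)
      ultimately show ?thesis unfolding count by (simp only:)
    qed
  qed
  from image_mset_eq_implies_permutes[OF finite_N this]
  have "\<exists>w. w permutes N \<and> (\<forall>i\<in>N. c (w i) = colour lam i)" by metis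
  from someI_ex[OF this]
  show p: "perm_of c permutes N" and q: "\<And>i. i \<in> N \<Longrightarrow> c (perm_of c i) = colour lam i"
    unfolding perm_of_def by blast+
  show "colour lam (inv' (perm_of c) i) = c i" if "i \<in> N" for i
    using q[of "inv' (perm_of c) i"] that permutes_inv_apply[OF p] by simp
qed

text \<open>The vector part can be zero: membership in the Young subgroup constrains only the
  permutation, so every coset contains a pure permutation.\<close>

definition rep_of :: "(nat \<Rightarrow> nat) \<Rightarrow> wreath_elt" where
  "rep_of c = (vec0, perm_of c)"

lemma rep_of_carrier: "c \<in> Col \<Longrightarrow> rep_of c \<in> carrier G"
  by (simp add: rep_of_def vec0_carrier perm_of)

lemma transversal_ex:
  assumes u: "u \<in> carrier G"
  shows "\<exists>c\<in>Col. inv\<^bsub>G\<^esub> u \<otimes>\<^bsub>G\<^esub> rep_of c \<in> H"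
proof -
  let ?w = "inv' (snd u)"
  have w: "?w permutes N" by (rule permutes_inv[OF snd_permutes[OF u]])
  define c where "c = (\<lambda>j\<in>N. colour lam (?w j))"
  have card: "card {i \<in> N. c i = k} = a k" if k: "k < r" for k
  proof -
    have "bij_betw ?w {i \<in> N. c i = k} (block lam k)"
      unfolding block_eq[OF k]
    proof (rule bij_betw_subset[OF permutes_imp_bij[OF w]])
      show "?w ` {i \<in> N. c i = k} = {i \<in> N. colour lam i = k}"
      proof
        show "{i \<in> N. colour lam i = k} \<subseteq> ?w ` {i \<in> N. c i = k}"
        proof
          fix i assume i: "i \<in> {i \<in> N. colour lam i = k}"
          then have "snd u i \<in> {i \<in> N. c i = k}"
            using permutes_inv_apply[OF snd_permutes[OF u], of i] by (simp add: c_def)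
          then show "i \<in> ?w ` {i \<in> N. c i = k}"
            using permutes_inv_apply(2)[OF snd_permutes[OF u], of i] by (metis imageI)
        qed
      qed (use permutes_inv_apply(4)[OF w] in \<open>auto simp: c_def\<close>)
    qed auto
    then show ?thesis using bij_betw_same_card by (fastforce simp: block_def)
  qed
  have "c \<in> N \<rightarrow>\<^sub>E {..<r}" using colour_block(1) permutes_inv_apply(4)[OF w] by (auto simp: c_def)
  then have c: "c \<in> Col" using card by (simp add: colourings_def)
  have "colour lam (?w (perm_of c i)) = colour lam i" if "i \<in> N" for i
    using perm_of(2)[OF c that] permutes_inv_apply(4)[OF perm_of(1)[OF c]] that by (simp add: c_def)
  then have "inv\<^bsub>G\<^esub> u \<otimes>\<^bsub>G\<^esub> rep_of c \<in> H"
    using u rep_of_carrier[OF c] by (simp add: young_iff snd_mult snd_inv) (simp add: rep_of_def)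
  then show ?thesis using c by blast
qed

text \<open>The colouring is recovered from the coset: an element of \<open>H\<close> preserves
  standard colours, and comparing them at the preimage of \<open>j\<close> under
  \<open>perm_of c'\<close> gives \<open>c j = c' j\<close>.\<close>

lemma transversal_unique:
  assumes c: "c \<in> Col" "c' \<in> Col" and h: "inv\<^bsub>G\<^esub> rep_of c \<otimes>\<^bsub>G\<^esub> rep_of c' \<in> H"
  shows "c = c'"
proof (rule PiE_ext)
  show "c \<in> N \<rightarrow>\<^sub>E {..<r}" "c' \<in> N \<rightarrow>\<^sub>E {..<r}" using c by (auto simp: colourings_def)
  fix j assume j: "j \<in> N"
  define i where "i = inv' (perm_of c') j"
  have i: "i \<in> N" "perm_of c' i = j" using j permutes_inv_apply[OF perm_of(1)[OF c(2)]] by (auto simp: i_def)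
  have "colour lam (snd (inv\<^bsub>G\<^esub> rep_of c \<otimes>\<^bsub>G\<^esub> rep_of c') i) = colour lam i" using h i young_iff by blast
  then have "colour lam (inv' (perm_of c) j) = colour lam i"
    using rep_of_carrier[OF c(1)] i by (simp add: snd_mult snd_inv) (simp add: rep_of_def i)
  then show "c j = c' j" using perm_of(3)[OF c(1) j] perm_of(2)[OF c(2) i(1)] i by simp
qed

end

section \<open>The induced representation\<close>

definition specht_basis :: "nat list \<Rightarrow> (nat \<Rightarrow> nat) set \<times> ((nat \<Rightarrow> nat) \<Rightarrow> (nat \<Rightarrow> nat) \<Rightarrow> complex)" where
  "specht_basis \<mu> = (SOME b. lagrange_basis (rep_space (specht \<mu>)) (fst b) (snd b))"

definition specht_points :: "nat list \<Rightarrow> (nat \<Rightarrow> nat) set" where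
  "specht_points \<mu> = fst (specht_basis \<mu>)"

definition specht_fun :: "nat list \<Rightarrow> (nat \<Rightarrow> nat) \<Rightarrow> (nat \<Rightarrow> nat) \<Rightarrow> complex" where
  "specht_fun \<mu> = snd (specht_basis \<mu>)"

lemma specht_lagrange: "lagrange_basis (rep_space (specht \<mu>)) (specht_points \<mu>) (specht_fun \<mu>)"
proof -
  have "\<exists>b. lagrange_basis (rep_space (specht \<mu>)) (fst b) (snd b)" using specht_lagrange_exists[of \<mu>] by auto
  from someI_ex[OF this] show ?thesis
    unfolding specht_points_def specht_fun_def specht_basis_def .
qed

lemma card_specht_points: "card (specht_points \<mu>) = f_dim \<mu>"
  by (simp add: f_dim_def rep_dim_def lagrange_dim[OF specht_lagrange])

lemma specht_char_eq:
  assumes "w permutes {1..sum_list \<mu>}"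
  shows "rep_char (specht \<mu>) w = (\<Sum>p\<in>specht_points \<mu>. specht_fun \<mu> p (p \<circ> w))"
  unfolding rep_char_def
  by (subst trace_on_lagrange[OF specht_lagrange specht_act_linear specht_act_closed[OF assms]])
    (simp_all add: specht_act)

lemma twisted_specht_act:
  "rep_act (twisted_specht \<zeta> k \<mu>) h f =
    cscale (\<zeta> powi (int k * (\<Sum>i=1..sum_list \<mu>. fst h i))) (rep_act (specht \<mu>) (snd h) f)"
  by (cases h) (simp add: twisted_specht_def)

context wreath_rep
begin

section \<open>The action of the Young subgroup on the tensor product\<close>

abbreviation "\<sigma> \<equiv> block_rep \<zeta> r lam"

definition bperm :: "wreath_elt \<Rightarrow> nat \<Rightarrow> nat \<Rightarrow> nat" where
  "bperm h k = snd (block_component lam h k)"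

text \<open>The product of the scalar twists of all factors: a coordinate in block \<open>k\<close>
  enters the exponent with weight \<open>k\<close>.\<close>

definition phase :: "wreath_elt \<Rightarrow> complex" where
  "phase h = \<zeta> powi (\<Sum>i\<in>N. int (colour lam i) * fst h i)"

text \<open>Agrees with the action of \<open>h\<close> on the space of \<open>\<sigma>\<close>; outside that space the latter is
  an unspecified linear extension.\<close>

definition block_op :: "wreath_elt \<Rightarrow> ((nat \<Rightarrow> nat \<Rightarrow> nat) \<Rightarrow> complex) \<Rightarrow> (nat \<Rightarrow> nat \<Rightarrow> nat) \<Rightarrow> complex" where
  "block_op h F = (\<lambda>x. if x \<in> extensional {..<r}
     then phase h * F (\<lambda>k\<in>{..<r}. x k \<circ> bperm h k) else 0)"

lemma bperm_eq: "bperm h k = (\<lambda>i. if i \<in> {1..a k} then snd h (off k + i) - off k else i)"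
  by (simp add: bperm_def block_component_def split_beta)

lemma block_phase:
  "(\<Prod>k<r. \<zeta> powi (int k * (\<Sum>i=1..sum_list (lam ! k). fst (block_component lam h k) i))) = phase h"
proof -
  have "(\<Sum>i=1..sum_list (lam ! k). fst (block_component lam h k) i) = (\<Sum>j\<in>block lam k. fst h j)" for k
  proof -
    have "(\<Sum>i=1..sum_list (lam ! k). fst (block_component lam h k) i) = (\<Sum>i\<in>{1..a k}. fst h (off k + i))"
      unfolding part_size_def[symmetric] by (cases h) (auto simp: block_component_def intro!: sum.cong)
    then show ?thesis by (simp only: sum.reindex_bij_betw[OF bij_off])
  qed
  then have "(\<Prod>k<r. \<zeta> powi (int k * (\<Sum>i=1..sum_list (lam ! k). fst (block_component lam h k) i)))
      = \<zeta> powi (\<Sum>k<r. \<Sum>j\<in>block lam k. int k * fst h j)"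
    by (simp add: powi_sum[OF zeta_nz] sum_distrib_left)
  then show ?thesis unfolding phase_def sum_over_blocks .
qed

lemma block_op_linear: "Vector_Spaces.linear cscale cscale (block_op h)"
  by (rule linearI_cscale) (auto simp: block_op_def fun_eq_iff cscale_apply algebra_simps)

lemma block_op_pure:
  "block_op h (pure_tensor {..<r} v) =
    pure_tensor {..<r} (\<lambda>k. rep_act (twisted_specht \<zeta> k (lam ! k)) (block_component lam h k) (v k))"
  unfolding block_op_def pure_tensor_def twisted_specht_act
  by (auto simp: fun_eq_iff cscale_apply specht_act prod.distrib block_phase[unfolded One_nat_def] bperm_def)

lemma space_\<sigma>: "rep_space \<sigma> = tensor_space {..<r} (\<lambda>k. rep_space (specht (lam ! k)))"
  by (simp add: block_rep_def outer_tensor_def twisted_specht_def)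

lemma act_\<sigma>: "rep_act \<sigma> h = tensor_map {..<r} (\<lambda>k. rep_space (specht (lam ! k)))
    (\<lambda>k. rep_act (twisted_specht \<zeta> k (lam ! k)) (block_component lam h k))"
proof -
  have "rep_space (twisted_specht \<zeta> k \<mu>) = rep_space (specht \<mu>)" for k \<mu> by (simp add: twisted_specht_def)
  then show ?thesis by (simp add: block_rep_def outer_tensor_def)
qed

lemma act_\<sigma>_linear: "Vector_Spaces.linear cscale cscale (rep_act \<sigma> h)"
  unfolding act_\<sigma> by (rule tensor_map_linear[OF block_op_linear block_op_pure])

lemma act_\<sigma>_eq: "F \<in> rep_space \<sigma> \<Longrightarrow> rep_act \<sigma> h F = block_op h F"
  unfolding act_\<sigma> space_\<sigma> by (rule tensor_map_eq[OF block_op_linear block_op_pure])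

lemma young_block:
  assumes "h \<in> H" "k < r"
  shows "snd h ` block lam k = block lam k"
  using assms by (cases h) (simp add: young_subgroup_def)

lemma young_snd_permutes: "h \<in> H \<Longrightarrow> snd h permutes N"
  using snd_permutes by (simp add: young_iff)

lemma bperm_permutes:
  assumes h: "h \<in> H" and k: "k < r"
  shows "bperm h k permutes {1..a k}"
proof (rule bij_imp_permutes)
  have "bij_betw (snd h) (block lam k) (block lam k)"
    using young_block[OF h k] permutes_inj_on[OF young_snd_permutes[OF h]] by (simp add: bij_betw_def)
  from bij_betw_trans[OF bij_betw_trans[OF bij_off this] bij_off']
  show "bij_betw (bperm h k) {1..a k} {1..a k}"
    by (rule bij_betw_cong[THEN iffD1, rotated]) (simp add: bperm_eq)
qed (simp only: bperm_eq if_False)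

lemma bperm_mult:
  assumes h: "h \<in> H" and h': "h' \<in> H" and k: "k < r"
  shows "bperm (h \<otimes>\<^bsub>G\<^esub> h') k = bperm h k \<circ> bperm h' k"
proof
  fix i
  show "bperm (h \<otimes>\<^bsub>G\<^esub> h') k i = (bperm h k \<circ> bperm h' k) i"
  proof (cases "i \<in> {1..a k}")
    case True
    then have "off k + i \<in> block lam k" by (simp add: block_def)
    \<comment> \<open>Stability of the block makes the truncated subtraction of the offset exact, so
      adding the offset back restores the point.\<close>
    then have "snd h' (off k + i) \<in> block lam k" using young_block[OF h' k] by blast
    moreover from this have "snd h' (off k + i) - off k \<in> {1..a k}" by (auto simp: block_def)
    ultimately show ?thesis using True by (simp add: bperm_eq snd_mult block_def)
  next
    case False
    then show ?thesis by (simp only: bperm_eq comp_apply if_False)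
  qed
qed

text \<open>The product shifts the coordinates of the second vector by a permutation. Since this
  permutation preserves colours, reindexing leaves the weighted sum unchanged.\<close>

lemma phase_mult:
  assumes h: "h \<in> H" and h': "h' \<in> H"
  shows "phase (h \<otimes>\<^bsub>G\<^esub> h') = phase h * phase h'"
proof -
  obtain x w y v where hh: "h = (x, w)" "h' = (y, v)" by (cases h, cases h')
  have w: "w permutes N" using young_snd_permutes[OF h] by (simp add: hh)
  have "(\<Sum>i\<in>N. int (colour lam i) * fst (h \<otimes>\<^bsub>G\<^esub> h') i) mod int r
      = (\<Sum>i\<in>N. int (colour lam i) * (x i + y (inv' w i))) mod int r"
    by (subst (1 2) mod_sum_eq[symmetric])
      (rule arg_cong[where f = "\<lambda>x. x mod int r"], rule sum.cong, auto simp: hh mult_eq mod_mult_right_eq)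
  then have "phase (h \<otimes>\<^bsub>G\<^esub> h') = \<zeta> powi (\<Sum>i\<in>N. int (colour lam i) * (x i + y (inv' w i)))"
    unfolding phase_def by (rule powi_cong[OF zeta_nz zeta])
  also have "\<dots> = phase h * \<zeta> powi (\<Sum>i\<in>N. int (colour lam i) * y (inv' w i))"
    by (simp add: phase_def hh distrib_left sum.distrib power_int_add zeta_nz)
  also have "(\<Sum>i\<in>N. int (colour lam i) * y (inv' w i)) = (\<Sum>i\<in>N. int (colour lam (w i)) * y i)"
    by (subst sum.reindex_bij_betw[OF permutes_imp_bij[OF w], symmetric]) (simp add: permutes_inv_apply[OF w])
  also have "\<dots> = (\<Sum>i\<in>N. int (colour lam i) * y i)"
    using h by (intro sum.cong) (auto simp: young_iff hh)
  finally show ?thesis by (simp add: phase_def hh)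
qed

lemma block_op_mult:
  assumes "h \<in> H" "h' \<in> H"
  shows "block_op (h \<otimes>\<^bsub>G\<^esub> h') F = block_op h (block_op h' F)"
proof
  fix x :: "nat \<Rightarrow> nat \<Rightarrow> nat"
  have "(\<lambda>k\<in>{..<r}. x k \<circ> bperm (h \<otimes>\<^bsub>G\<^esub> h') k) = (\<lambda>k\<in>{..<r}. x k \<circ> (bperm h k \<circ> bperm h' k))"
    using bperm_mult[OF assms] by (auto simp: fun_eq_iff)
  moreover have "(\<lambda>k\<in>{..<r}. (if k < r then x k \<circ> bperm h k else undefined) \<circ> bperm h' k)
      = (\<lambda>k\<in>{..<r}. x k \<circ> (bperm h k \<circ> bperm h' k))"
    by (auto simp: fun_eq_iff)
  ultimately show "block_op (h \<otimes>\<^bsub>G\<^esub> h') F x = block_op h (block_op h' F) x"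
    by (simp add: block_op_def phase_mult[OF assms])
qed

lemma block_op_closed:
  assumes h: "h \<in> H" and F: "F \<in> rep_space \<sigma>"
  shows "block_op h F \<in> rep_space \<sigma>"
proof -
  let ?V = "\<lambda>k. rep_space (specht (lam ! k))"
  have "block_op h F \<in> cfun.span {pure_tensor {..<r} v |v. \<forall>k\<in>{..<r}. v k \<in> ?V k}"
  proof (rule linear_image_cspan[OF block_op_linear])
    show "F \<in> cfun.span {pure_tensor {..<r} v |v. \<forall>k\<in>{..<r}. v k \<in> ?V k}"
      using F by (simp add: space_\<sigma> tensor_space_def)
    fix x assume "x \<in> {pure_tensor {..<r} v |v. \<forall>k\<in>{..<r}. v k \<in> ?V k}"
    then obtain v where v: "x = pure_tensor {..<r} v" "\<And>k. k < r \<Longrightarrow> v k \<in> ?V k" by auto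
    have "rep_act (twisted_specht \<zeta> k (lam ! k)) (block_component lam h k) (v k) \<in> ?V k" if "k < r" for k
    proof -
      have "bperm h k permutes {1..sum_list (lam ! k)}"
        using bperm_permutes[OF h that] by (simp add: part_size_def)
      from specht_act_closed[OF this v(2)[OF that]] show ?thesis
        unfolding twisted_specht_act bperm_def
        by (intro cfun.subspace_scale[OF lagrange_basisD(1)[OF specht_lagrange]])
    qed
    then show "block_op h x \<in> cfun.span {pure_tensor {..<r} v |v. \<forall>k\<in>{..<r}. v k \<in> ?V k}"
      unfolding v(1) block_op_pure by (intro cfun.span_base) blast
  qed
  then show ?thesis by (simp add: space_\<sigma> tensor_space_def)
qed

lemma bperm_id: "snd h = id \<Longrightarrow> bperm h k = id"
  by (auto simp: bperm_eq fun_eq_iff)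

definition pts :: "(nat \<Rightarrow> nat \<Rightarrow> nat) set" where
  "pts = PiE {..<r} (\<lambda>k. specht_points (lam ! k))"

definition bas :: "(nat \<Rightarrow> nat \<Rightarrow> nat) \<Rightarrow> (nat \<Rightarrow> nat \<Rightarrow> nat) \<Rightarrow> complex" where
  "bas \<xi> = pure_tensor {..<r} (\<lambda>k. specht_fun (lam ! k) (\<xi> k))"

lemma lagrange_\<sigma>: "lagrange_basis (rep_space \<sigma>) pts bas"
  unfolding space_\<sigma> pts_def bas_def[abs_def] by (rule lagrange_tensor) (auto intro: specht_lagrange)

lemma \<sigma>_vanish:
  assumes F: "F \<in> rep_space \<sigma>" and x: "x \<notin> extensional {..<r}"
  shows "F x = 0"
  using lagrange_basisD(6)[OF lagrange_\<sigma> F, of x] x by (simp add: bas_def pure_tensor_def)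

lemma block_op_scalar:
  assumes F: "F \<in> rep_space \<sigma>" and h: "snd h = id"
  shows "block_op h F x = phase h * F x"
proof (cases "x \<in> extensional {..<r}")
  case True
  then show ?thesis by (simp add: block_op_def bperm_id[OF h] extensional_restrict)
next
  case False
  then show ?thesis by (simp add: block_op_def \<sigma>_vanish[OF F])
qed

lemma phase_vec0: "phase (vec0, w) = 1"
proof -
  have "(\<Sum>i\<in>N. int (colour lam i) * fst (vec0, w) i) = 0" by (rule sum.neutral) (simp add: vec0_def)
  then show ?thesis by (simp add: phase_def)
qed

text \<open>The trace of a tensor product of operators is the product of the traces: a sum over
  tuples of sample points factors into sums over the components.\<close>

lemma bas_trace:
  assumes h: "h \<in> H"
  shows "(\<Sum>\<xi>\<in>pts. rep_act \<sigma> h (bas \<xi>) \<xi>) = phase h * (\<Prod>k<r. rep_char (specht (lam ! k)) (bperm h k))"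
proof -
  have "(\<Sum>\<xi>\<in>pts. rep_act \<sigma> h (bas \<xi>) \<xi>)
      = (\<Sum>\<xi>\<in>pts. phase h * (\<Prod>k<r. specht_fun (lam ! k) (\<xi> k) (\<xi> k \<circ> bperm h k)))"
  proof (rule sum.cong[OF refl])
    fix \<xi> assume \<xi>: "\<xi> \<in> pts"
    then have "\<xi> \<in> extensional {..<r}" by (simp add: pts_def PiE_iff)
    then show "rep_act \<sigma> h (bas \<xi>) \<xi> = phase h * (\<Prod>k<r. specht_fun (lam ! k) (\<xi> k) (\<xi> k \<circ> bperm h k))"
      using act_\<sigma>_eq[OF lagrange_basisD(3)[OF lagrange_\<sigma> \<xi>], of h]
      by (simp add: block_op_def bas_def pure_tensor_def)
  qed
  also have "\<dots> = phase h * (\<Prod>k<r. \<Sum>p\<in>specht_points (lam ! k). specht_fun (lam ! k) p (p \<circ> bperm h k))"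
    unfolding pts_def
    by (subst prod_sum_PiE) (use lagrange_basisD(2)[OF specht_lagrange] in \<open>auto simp: sum_distrib_left\<close>)
  also have "\<dots> = phase h * (\<Prod>k<r. rep_char (specht (lam ! k)) (bperm h k))"
    using bperm_permutes[OF h] by (simp add: specht_char_eq part_size_def)
  finally show ?thesis .
qed

sublocale ind: induced_lagrange G H \<sigma> "rep_of ` Col" pts bas
proof (intro induced_lagrange.intro induced_lagrange_axioms.intro)
  show "group G" by (rule group_wreath_group)
  show "subgroup H G" by (rule subgroup_young)
  show "Vector_Spaces.linear cscale cscale (rep_act \<sigma> h)" if "h \<in> H" for h by (rule act_\<sigma>_linear)
  show "rep_act \<sigma> h F \<in> rep_space \<sigma>" if "h \<in> H" "F \<in> rep_space \<sigma>" for h F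
    unfolding act_\<sigma>_eq[OF that(2)] by (rule block_op_closed[OF that])
  show "rep_act \<sigma> (h \<otimes>\<^bsub>G\<^esub> h') F = rep_act \<sigma> h (rep_act \<sigma> h' F)"
    if "h \<in> H" "h' \<in> H" "F \<in> rep_space \<sigma>" for h h' F
    using that block_op_closed[of h' F] by (simp add: act_\<sigma>_eq block_op_mult)
  show "rep_act \<sigma> \<one>\<^bsub>G\<^esub> F = F" if "F \<in> rep_space \<sigma>" for F
    using that block_op_scalar[OF that, of "\<one>\<^bsub>G\<^esub>"] by (simp add: act_\<sigma>_eq one_eq phase_vec0 fun_eq_iff)
  show "lagrange_basis (rep_space \<sigma>) pts bas" by (rule lagrange_\<sigma>)
  show "finite (rep_of ` Col)" by (simp add: finite_colourings)
  show "rep_of ` Col \<subseteq> carrier G" using rep_of_carrier by blast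
  show "\<exists>c\<in>rep_of ` Col. inv\<^bsub>G\<^esub> u \<otimes>\<^bsub>G\<^esub> c \<in> H" if "u \<in> carrier G" for u
    using transversal_ex[OF that] by blast
  show "c = c'" if "c \<in> rep_of ` Col" "c' \<in> rep_of ` Col" "inv\<^bsub>G\<^esub> c \<otimes>\<^bsub>G\<^esub> c' \<in> H" for c c'
    using that transversal_unique by blast
qed

lemma inj_rep_of: "inj_on rep_of Col"
proof
  fix c c' assume c: "c \<in> Col" "c' \<in> Col" "rep_of c = rep_of c'"
  have "inv\<^bsub>G\<^esub> rep_of c \<otimes>\<^bsub>G\<^esub> rep_of c' \<in> H"
    using rep_of_carrier[OF c(1)] c(3) subgroup.one_closed[OF subgroup_young] by simp
  then show "c = c'" by (rule transversal_unique[OF c(1,2)])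
qed

section \<open>Multiplicativity of the determinant and its values on translations\<close>

lemma rep_det_rho: "rep_det (rho_lambda \<zeta> n r lam) g = det_on ind.V (ind.act g)"
  by (simp add: rho_lambda_def rep_det_def)

lemma det_mult:
  assumes "g \<in> carrier G" "g' \<in> carrier G"
  shows "det_on ind.V (ind.act (g \<otimes>\<^bsub>G\<^esub> g')) = det_on ind.V (ind.act g) * det_on ind.V (ind.act g')"
proof -
  have "ind.act (g \<otimes>\<^bsub>G\<^esub> g') = (\<lambda>F. ind.act g (ind.act g' F))"
    by (rule ext) (rule ind.act_mult_induced[OF assms])
  then show ?thesis
    using det_on_compose[OF ind.lagrange_induced ind.act_linear ind.act_closed[OF assms(1)]
      ind.act_linear ind.act_closed[OF assms(2)]] by simp
qed

lemma vec0_mult: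
  assumes "w permutes N"
  shows "(vec0, w) \<otimes>\<^bsub>G\<^esub> (vec0, v) = (vec0, w \<circ> v)"
  using permutes_inv_apply[OF assms] by (auto simp: mult_eq vec0_def fun_eq_iff)

lemma inv_vec0:
  assumes w: "w permutes N"
  shows "inv\<^bsub>G\<^esub> (vec0, w) = (vec0, inv' w)"
  using vec0_mult[OF permutes_inv[OF w], of w] vec0_carrier[OF w] vec0_carrier[OF permutes_inv[OF w]]
  by (intro inv_equality) (simp_all add: one_eq permutes_inv_o(2)[OF w])

text \<open>Conjugation by a representative only permutes the coordinates of the translation. The
  reductions modulo \<open>r\<close> in the products have no effect because the entries of
  \<open>x\<close> are already reduced.\<close>

lemma conj_translation:
  assumes c: "c \<in> Col" and x: "(x, id) \<in> carrier G"
  shows "inv\<^bsub>G\<^esub> rep_of c \<otimes>\<^bsub>G\<^esub> (x, id) \<otimes>\<^bsub>G\<^esub> rep_of c = (\<lambda>i\<in>N. x (perm_of c i), id)"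
proof -
  let ?w = "perm_of c"
  note w = perm_of(1)[OF c]
  have xr: "x i mod int r = x i" if "i \<in> N" for i
    using x that by (auto simp: carrier_iff PiE_iff)
  show ?thesis
    unfolding rep_of_def inv_vec0[OF w]
    using permutes_inv_apply[OF w] permutes_inv_o(2)[OF w] permutes_inv_inv[OF w]
      permutes_inv_inv[OF permutes_inv[OF w]]
    by (auto simp: mult_eq vec0_def fun_eq_iff xr mod_simps)
qed

lemma phase_conj_translation:
  assumes c: "c \<in> Col"
  shows "phase (\<lambda>i\<in>N. x (perm_of c i), id) = \<zeta> powi (\<Sum>i\<in>N. int (c i) * x i)"
proof -
  have "(\<Sum>i\<in>N. int (colour lam i) * fst (\<lambda>i\<in>N. x (perm_of c i), id) i)
      = (\<Sum>i\<in>N. int (c (perm_of c i)) * x (perm_of c i))"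
    by (rule sum.cong) (simp_all add: perm_of(2)[OF c])
  also have "\<dots> = (\<Sum>i\<in>N. int (c i) * x i)"
    by (rule sum.reindex_bij_betw[OF permutes_imp_bij[OF perm_of(1)[OF c]]])
  finally show ?thesis by (simp add: phase_def)
qed

lemma card_pts: "card pts = (\<Prod>k<r. f_dim (lam ! k))"
  by (simp add: pts_def card_PiE card_specht_points)

text \<open>A translation fixes every coset: its permutation part is trivial, so the conjugating
  product lies in \<open>H\<close> only if both representatives coincide. On the block of
  \<open>c\<close> the conjugate is again a translation and acts by its phase, which enters the
  determinant \<open>card pts\<close> times.\<close>

lemma det_translation:
  assumes x: "(x, id) \<in> carrier G"
  shows "det_on ind.V (ind.act (x, id)) = (\<Prod>c\<in>Col. (\<zeta> powi (\<Sum>i\<in>N. int (c i) * x i)) ^ card pts)"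
proof -
  let ?g = "(x, id :: nat \<Rightarrow> nat)"
  let ?d = "\<lambda>p. phase (inv\<^bsub>G\<^esub> fst p \<otimes>\<^bsub>G\<^esub> ?g \<otimes>\<^bsub>G\<^esub> fst p)"
  have "det_on ind.V (ind.act ?g) = (\<Prod>p\<in>rep_of ` Col \<times> pts. ?d p)"
  proof (rule det_on_diagonal[OF ind.lagrange_induced ind.act_linear ind.act_closed[OF x]])
    fix p q assume pq: "p \<in> rep_of ` Col \<times> pts" "q \<in> rep_of ` Col \<times> pts"
    obtain c \<xi> c' \<xi>' where p: "p = (rep_of c, \<xi>)" "c \<in> Col" "\<xi> \<in> pts"
      and q: "q = (rep_of c', \<xi>')" "c' \<in> Col" "\<xi>' \<in> pts" using pq by auto
    note ca = rep_of_carrier[OF p(2)] rep_of_carrier[OF q(2)]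
    let ?h = "inv\<^bsub>G\<^esub> rep_of c' \<otimes>\<^bsub>G\<^esub> ?g \<otimes>\<^bsub>G\<^esub> rep_of c"
    have act: "ind.act ?g (ind.ind_fun p) q = (if ?h \<in> H then rep_act \<sigma> ?h (bas \<xi>) \<xi>' else 0)"
      unfolding p q by (rule ind.act_ind_fun[OF x]) (use p q in auto)
    have "snd ?h = snd (inv\<^bsub>G\<^esub> rep_of c' \<otimes>\<^bsub>G\<^esub> rep_of c)" by (simp add: snd_mult)
    moreover have "?h \<in> carrier G" "inv\<^bsub>G\<^esub> rep_of c' \<otimes>\<^bsub>G\<^esub> rep_of c \<in> carrier G"
      by (intro m_closed inv_closed ca x)+
    ultimately have "?h \<in> H \<longleftrightarrow> inv\<^bsub>G\<^esub> rep_of c' \<otimes>\<^bsub>G\<^esub> rep_of c \<in> H" by (simp only: young_iff)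
    then have hH: "?h \<in> H \<longleftrightarrow> c' = c"
      using transversal_unique[OF q(2) p(2)] ca subgroup.one_closed[OF subgroup_young] by auto
    show "ind.act ?g (ind.ind_fun p) q = (if p = q then ?d p else 0)"
    proof (cases "c' = c")
      case True
      have "snd ?h = id" unfolding True conj_translation[OF p(2) x] by simp
      from block_op_scalar[OF lagrange_basisD(3)[OF lagrange_\<sigma> p(3)] this, of \<xi>']
      have "rep_act \<sigma> ?h (bas \<xi>) \<xi>' = phase ?h * bas \<xi> \<xi>'"
        using act_\<sigma>_eq[OF lagrange_basisD(3)[OF lagrange_\<sigma> p(3)]] by simp
      then show ?thesis unfolding act using hH True lagrange_basisD(4)[OF lagrange_\<sigma> p(3) q(3)] p q by auto
    next
      case False
      then have "p \<noteq> q" using p q inj_rep_of by (auto simp: inj_on_def)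
      then show ?thesis unfolding act using hH False by simp
    qed
  qed
  also have "\<dots> = (\<Prod>u\<in>rep_of ` Col. \<Prod>\<xi>\<in>pts. ?d (u, \<xi>))"
    by (subst prod.cartesian_product) (rule prod.cong, auto)
  also have "\<dots> = (\<Prod>c\<in>Col. \<Prod>\<xi>\<in>pts. ?d (rep_of c, \<xi>))"
    by (simp only: prod.reindex[OF inj_rep_of] comp_def)
  also have "\<dots> = (\<Prod>c\<in>Col. (\<zeta> powi (\<Sum>i\<in>N. int (c i) * x i)) ^ card pts)"
    by (rule prod.cong[OF refl]) (simp add: conj_translation[OF _ x] phase_conj_translation)
  finally show ?thesis .
qed

end

section \<open>The determinant\<close>

lemma prod_list_map_nth: "(\<Prod>x\<leftarrow>xs. f x) = (\<Prod>i<length xs. f (xs ! i) :: nat)"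
  by (simp add: prod.list_conv_set_nth atLeast0LessThan)

lemma square_sum_nat:
  fixes a :: "nat \<Rightarrow> complex"
  shows "(\<Sum>k<r. a k) * (\<Sum>k<r. a k) = (\<Sum>k<r. a k * a k) + 2 * (\<Sum>j<r. \<Sum>i<j. a i * a j)"
  by (induction r) (simp_all add: algebra_simps sum_distrib_left sum_distrib_right)

context wreath_rep
begin

lemma length_lam: "length lam = r"
  using lam by (simp add: multipartitions_def)

text \<open>Passes from the integer list with a possibly negative entry to the counting functions on
  naturals, where the condition \<open>a k < d\<close> replaces the negative entry.\<close>

lemma reduced_multinomial_eq:
  assumes k: "k < r"
  shows "reduced_multinomial n lam k d =
    (if a k < d then 0 else fact (n - d) div (\<Prod>j<r. fact ((a(k := a k - d)) j)))"
proof -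
  define as where "as = (map (int \<circ> sum_list) lam)[k := int (a k) - int d]"
  have nth: "as ! j = (if j = k then int (a k) - int d else int (a j))" if "j < r" for j
    using that length_lam by (auto simp: as_def part_size_def nth_list_update)
  have len: "length as = r" by (simp add: as_def length_lam)
  have red: "reduced_multinomial n lam k d = multinomial (n - d) as"
    using k length_lam by (simp add: reduced_multinomial_def Let_def as_def part_size_def)
  have neg: "(\<exists>x\<in>set as. x < 0) \<longleftrightarrow> a k < d"
  proof
    assume "\<exists>x\<in>set as. x < 0"
    then obtain j where "j < r" "as ! j < 0" by (metis in_set_conv_nth len)
    then show "a k < d" using nth by (auto split: if_splits)
  next
    assume "a k < d"
    then have "as ! k < 0" using nth k by simp
    then show "\<exists>x\<in>set as. x < 0" using k len nth_mem by blast
  qed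
  have "(\<Prod>x\<leftarrow>as. fact (nat x)) = (\<Prod>j<r. fact ((a(k := a k - d)) j) :: nat)" if "\<not> a k < d"
    unfolding prod_list_map_nth len using that nth by (intro prod.cong) (auto simp: nat_diff_distrib)
  then show ?thesis unfolding red multinomial_def neg by simp
qed

lemma card_Col_fixed1:
  assumes "j \<in> N" "k < r"
  shows "card {c \<in> Col. c j = k} = reduced_multinomial n lam k 1"
  using card_colourings_fixed1[OF finite_N assms, of a] sum_a unfolding reduced_multinomial_eq[OF assms(2)] by simp

lemma card_Col_fixed2:
  assumes "p \<in> N" "q \<in> N" "p \<noteq> q" "k < r"
  shows "card {c \<in> Col. c p = k \<and> c q = k} = reduced_multinomial n lam k 2"
  using card_colourings_fixed2[OF finite_N assms, of a] sum_a unfolding reduced_multinomial_eq[OF assms(4)] by simp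

lemma Col_value: "c \<in> Col \<Longrightarrow> j \<in> N \<Longrightarrow> c j < r"
  by (auto simp: colourings_def)

text \<open>The result does not depend on the point \<open>j\<close>. This is why the determinant of
  a translation depends only on the sum of its coordinates.\<close>

lemma sum_Col_value:
  assumes "j \<in> N"
  shows "(\<Sum>c\<in>Col. c j) = (\<Sum>k=1..r-1. k * reduced_multinomial n lam k 1)"
proof -
  have "(\<Sum>c\<in>Col. c j) = (\<Sum>k<r. \<Sum>c\<in>{c \<in> Col. c j = k}. c j)"
    by (rule sum.group[symmetric]) (use Col_value[OF _ assms] finite_colourings[OF finite_N] in auto)
  also have "\<dots> = (\<Sum>k<r. k * reduced_multinomial n lam k 1)"
    by (intro sum.cong) (simp_all add: card_Col_fixed1[OF assms, unfolded One_nat_def] mult.commute)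
  \<comment> \<open>Colour 0 has weight 0 and drops out.\<close>
  also have "\<dots> = (\<Sum>k=1..r-1. k * reduced_multinomial n lam k 1)"
    by (rule sum.mono_neutral_right) auto
  finally show ?thesis .
qed

lemma det_translation_eq:
  assumes x: "(x, id) \<in> carrier G"
  shows "det_on ind.V (ind.act (x, id)) = (\<zeta> powi (\<Sum>i\<in>N. x i)) ^ x_lambda n r lam"
proof -
  let ?S = "\<Sum>k=1..r-1. k * reduced_multinomial n lam k 1"
  have "det_on ind.V (ind.act (x, id)) = (\<Prod>c\<in>Col. \<zeta> powi (\<Sum>i\<in>N. int (c i) * x i)) ^ card pts"
    unfolding det_translation[OF x] by (simp add: prod_power_distrib)
  also have "(\<Prod>c\<in>Col. \<zeta> powi (\<Sum>i\<in>N. int (c i) * x i)) = \<zeta> powi (\<Sum>i\<in>N. \<Sum>c\<in>Col. int (c i) * x i)"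
    by (subst sum.swap) (simp add: powi_sum[OF zeta_nz])
  also have "(\<Sum>i\<in>N. \<Sum>c\<in>Col. int (c i) * x i) = (\<Sum>i\<in>N. int (\<Sum>c\<in>Col. c i) * x i)"
    by (simp add: sum_distrib_right)
  also have "\<dots> = (\<Sum>i\<in>N. x i) * int ?S"
    unfolding sum_distrib_right by (rule sum.cong) (simp_all only: sum_Col_value mult.commute)
  finally show ?thesis
    by (simp only: power_int_mult power_int_of_nat x_lambda_def card_pts power_mult[symmetric] mult.commute)
qed

section \<open>The trace of a transposition\<close>

lemma conj_transpose:
  assumes c: "c \<in> Col" and pq: "p \<in> N" "q \<in> N"
  shows "inv\<^bsub>G\<^esub> rep_of c \<otimes>\<^bsub>G\<^esub> (vec0, Transposition.transpose p q) \<otimes>\<^bsub>G\<^esub> rep_of c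
    = (vec0, Transposition.transpose (inv' (perm_of c) p) (inv' (perm_of c) q))"
proof -
  note w = perm_of(1)[OF c]
  note iw = permutes_inv[OF w]
  have "inv' (perm_of c) \<circ> Transposition.transpose p q permutes N"
    by (rule permutes_compose[OF permutes_swap_id[OF pq] iw])
  then show ?thesis
    using comp_transpose_inv[OF permutes_bij[OF iw], of p q]
    by (simp add: rep_of_def inv_vec0[OF w] vec0_mult iw permutes_inv_inv[OF w])
qed

text \<open>The trace on the block of a fixed coset when both moved points have colour
  \<open>k\<close>: the factor \<open>k\<close> sees a transposition, every other factor the
  identity. For parts of size below 2 the value has no such meaning, but it is then always
  multiplied by a vanishing multinomial.\<close>

definition swap_trace :: "nat \<Rightarrow> complex" where
  "swap_trace k = rep_char (specht (lam ! k)) (Transposition.transpose 1 2)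
     * (\<Prod>j\<in>{..<r} - {k}. of_nat (f_dim (lam ! j)))"

lemma transpose_in_young_iff:
  assumes pq: "p \<in> N" "q \<in> N"
  shows "(vec0, Transposition.transpose p q) \<in> H \<longleftrightarrow> colour lam p = colour lam q"
proof
  assume "(vec0, Transposition.transpose p q) \<in> H"
  then have "colour lam (Transposition.transpose p q p) = colour lam p" using pq by (auto simp: young_iff)
  then show "colour lam p = colour lam q" by simp
next
  assume eq: "colour lam p = colour lam q"
  have "colour lam (Transposition.transpose p q i) = colour lam i" for i
    using eq by (auto simp: Transposition.transpose_def)
  then show "(vec0, Transposition.transpose p q) \<in> H"
    using vec0_carrier[OF permutes_swap_id[OF pq]] by (simp add: young_iff)
qed

lemma bas_trace_transpose:
  assumes pq: "p \<in> N" "q \<in> N" "p \<noteq> q" and eq: "colour lam p = k" "colour lam q = k"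
  shows "(\<Sum>\<xi>\<in>pts. rep_act \<sigma> (vec0, Transposition.transpose p q) (bas \<xi>) \<xi>) = swap_trace k"
proof -
  let ?h = "(vec0, Transposition.transpose p q)"
  have h: "?h \<in> H" using transpose_in_young_iff[OF pq(1,2)] eq by simp
  have k: "k < r" using colour_block(1)[OF pq(1)] eq by simp
  have blk: "p \<in> block lam k" "q \<in> block lam k" using colour_block(2)[OF pq(1)] colour_block(2)[OF pq(2)] eq by simp_all
  have other: "bperm ?h j = id" if "j < r" "j \<noteq> k" for j
  proof
    fix i
    have "i \<in> {1..a j} \<Longrightarrow> off j + i \<in> block lam j" by (simp add: block_def)
    then have "i \<in> {1..a j} \<Longrightarrow> off j + i \<noteq> p \<and> off j + i \<noteq> q" 
      using colour_eq[of "off j + i" lam j] eq that by auto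
    then show "bperm ?h j i = id i" by (auto simp: bperm_eq Transposition.transpose_def)
  qed
  have self: "bperm ?h k = Transposition.transpose (p - off k) (q - off k)"
  proof
    fix i
    have "p = off k + (p - off k)" "q = off k + (q - off k)"
      "p - off k \<in> {1..a k}" "q - off k \<in> {1..a k}" using blk by (auto simp: block_def)
    then show "bperm ?h k i = Transposition.transpose (p - off k) (q - off k) i"
      by (auto simp: bperm_eq Transposition.transpose_def)
  qed
  have "rep_char (specht (lam ! k)) (bperm ?h k) = rep_char (specht (lam ! k)) (Transposition.transpose 1 2)"
    unfolding self
    by (rule specht_char_transpose) (use blk pq in \<open>auto simp: block_def part_size_def\<close>)
  moreover have "(\<Prod>j<r. rep_char (specht (lam ! j)) (bperm ?h j))
      = rep_char (specht (lam ! k)) (bperm ?h k) * (\<Prod>j\<in>{..<r} - {k}. rep_char (specht (lam ! j)) (bperm ?h j))"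
    using k by (intro prod.remove) auto
  moreover have "(\<Prod>j\<in>{..<r} - {k}. rep_char (specht (lam ! j)) (bperm ?h j))
      = (\<Prod>j\<in>{..<r} - {k}. of_nat (f_dim (lam ! j)))"
    by (rule prod.cong) (simp_all add: other specht_char_id)
  ultimately show ?thesis unfolding bas_trace[OF h] phase_vec0 by (simp add: swap_trace_def)
qed

lemma trace_transpose:
  assumes pq: "p \<in> N" "q \<in> N" "p \<noteq> q"
  shows "(\<Sum>b\<in>rep_of ` Col \<times> pts. ind.act (vec0, Transposition.transpose p q) (ind.ind_fun b) b)
    = (\<Sum>k<r. of_nat (reduced_multinomial n lam k 2) * swap_trace k)"
proof -
  let ?g = "(vec0, Transposition.transpose p q)"
  have g: "?g \<in> carrier G" by (rule vec0_carrier[OF permutes_swap_id[OF pq(1,2)]])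
  have "(\<Sum>b\<in>rep_of ` Col \<times> pts. ind.act ?g (ind.ind_fun b) b)
      = (\<Sum>u\<in>rep_of ` Col. \<Sum>\<xi>\<in>pts. ind.act ?g (ind.ind_fun (u, \<xi>)) (u, \<xi>))"
    by (subst sum.cartesian_product) (rule sum.cong, auto)
  also have "\<dots> = (\<Sum>c\<in>Col. \<Sum>\<xi>\<in>pts. ind.act ?g (ind.ind_fun (rep_of c, \<xi>)) (rep_of c, \<xi>))"
    by (simp only: sum.reindex[OF inj_rep_of] comp_def)
  also have "\<dots> = (\<Sum>c\<in>Col. if c p = c q then swap_trace (c p) else 0)"
  proof (rule sum.cong[OF refl])
    fix c assume c: "c \<in> Col"
    let ?p = "inv' (perm_of c) p" and ?q = "inv' (perm_of c) q"
    note w = perm_of(1)[OF c]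
    have pq': "?p \<in> N" "?q \<in> N" "?p \<noteq> ?q"
      using pq permutes_inv_apply[OF w] by (simp_all, metis)
    \<comment> \<open>The conjugated transposition moves the preimages of \<open>p\<close> and
      \<open>q\<close>, whose standard colours are the values of \<open>c\<close>. It therefore lies
      in the Young subgroup exactly when \<open>c p = c q\<close>.\<close>
    have col: "colour lam ?p = c p" "colour lam ?q = c q" using perm_of(3)[OF c] pq by auto
    have "ind.act ?g (ind.ind_fun (rep_of c, \<xi>)) (rep_of c, \<xi>)
        = (if c p = c q then rep_act \<sigma> (vec0, Transposition.transpose ?p ?q) (bas \<xi>) \<xi> else 0)" for \<xi>
      using ind.act_ind_fun[OF g, of "rep_of c" "rep_of c" \<xi> \<xi>] c
      by (simp add: conj_transpose[OF c pq(1,2)] transpose_in_young_iff[OF pq'(1,2)] col)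
    then show "(\<Sum>\<xi>\<in>pts. ind.act ?g (ind.ind_fun (rep_of c, \<xi>)) (rep_of c, \<xi>))
        = (if c p = c q then swap_trace (c p) else 0)"
      using bas_trace_transpose[OF pq' col(1)] col(2) by simp
  qed
  also have "\<dots> = (\<Sum>k<r. \<Sum>c\<in>{c \<in> Col. c p = k}. if c p = c q then swap_trace (c p) else 0)"
    by (rule sum.group[symmetric]) (use Col_value[OF _ pq(1)] finite_colourings[OF finite_N] in auto)
  also have "\<dots> = (\<Sum>k<r. \<Sum>c\<in>{c \<in> Col. c p = k \<and> c q = k}. swap_trace k)"
    by (rule sum.cong[OF refl], rule sum.mono_neutral_cong_right)
      (use finite_colourings[OF finite_N] in auto)
  also have "\<dots> = (\<Sum>k<r. of_nat (reduced_multinomial n lam k 2) * swap_trace k)"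
    by (intro sum.cong) (simp_all add: card_Col_fixed2[OF pq])
  finally show ?thesis .
qed

section \<open>Comparison of dimension and trace with \<open>y_lambda\<close>\<close>

lemma card_Col: "card Col * (\<Prod>k<r. fact (a k)) = fact n"
  using card_colourings[OF finite_N, of a r] sum_a by simp

lemma reduced_multinomial_2:
  assumes k: "k < r"
  shows "reduced_multinomial n lam k 2 * (\<Prod>j<r. fact (a j)) = fact (n - 2) * (a k * (a k - 1))"
proof (cases "a k < 2")
  case True
  then have "a k = 0 \<or> a k = 1" by auto
  then show ?thesis using True k by (auto simp: reduced_multinomial_eq)
next
  case False
  define b where "b = a(k := a k - 1)"
  define b' where "b' = a(k := a k - 2)"
  have b': "b' = b(k := b k - 1)" by (simp add: b_def b'_def numeral_2_eq_2)
  have "(\<Sum>j<r. b' j) + 2 = (\<Sum>j<r. a j)" unfolding b'_def by (rule sum_fun_upd_pred) (use k False in auto)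
  then have "(\<Sum>j<r. b' j) = card {..<n - 2}" using sum_a by simp
  from card_colourings[OF _ this] have "card (colourings {..<n - 2} r b') * (\<Prod>j<r. fact (b' j)) = fact (n - 2)" by simp
  \<comment> \<open>The natural division is exact because the quotient counts colourings of a set
    with \<open>n - 2\<close> points.\<close>
  then have "fact (n - 2) div (\<Prod>j<r. fact (b' j)) * (\<Prod>j<r. fact (b' j)) = (fact (n - 2) :: nat)"
    by (metis dvd_div_mult_self dvd_triv_right)
  then have red: "reduced_multinomial n lam k 2 * (\<Prod>j<r. fact (b' j)) = fact (n - 2)"
    using False unfolding reduced_multinomial_eq[OF k] b'_def[symmetric] by simp
  have "(\<Prod>j<r. fact (a j) :: nat) = a k * (\<Prod>j<r. fact (b j))"
    unfolding b_def by (rule prod_fact_fun_upd_pred) (use k False in auto)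
  moreover have "(\<Prod>j<r. fact (b j) :: nat) = b k * (\<Prod>j<r. fact (b' j))"
    unfolding b' by (rule prod_fact_fun_upd_pred) (use k False in \<open>auto simp: b_def\<close>)
  moreover have "b k = a k - 1" by (simp add: b_def)
  ultimately have "(\<Prod>j<r. fact (a j) :: nat) = a k * ((a k - 1) * (\<Prod>j<r. fact (b' j)))" by simp
  then show ?thesis unfolding red[symmetric] by (simp only: mult_ac)
qed

text \<open>The right side is the dimension minus the trace of a transposition. Squaring the sum of
  the part sizes splits \<open>n * n - n\<close> into the terms \<open>a k * a k - a k\<close> and
  twice the mixed products; multiplied by \<open>fact (n - 2)\<close> over the product of the
  \<open>fact (a k)\<close>, this splits the number of colourings into those with equal and those
  with different values at two points.\<close>

lemma y_lambda_eq:
  assumes n: "n \<ge> 2"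
  shows "2 * y_lambda n r lam = of_nat (card Col * card pts)
    - (\<Sum>k<r. of_nat (reduced_multinomial n lam k 2) * swap_trace k)"
proof -
  define D :: complex where "D = (\<Prod>k<r. fact (a k))"
  define P :: complex where "P = (\<Prod>k<r. of_nat (f_dim (lam ! k)))"
  define M where "M k = (of_nat (reduced_multinomial n lam k 2) :: complex)" for k
  define E :: complex where "E = (\<Sum>j<r. \<Sum>i<j. of_nat (a i) * of_nat (a j))"
  have D: "D \<noteq> 0" by (simp add: D_def)
  have M: "M k * D = fact (n - 2) * (of_nat (a k) * of_nat (a k) - of_nat (a k))" if "k < r" for k
  proof -
    have "of_nat (reduced_multinomial n lam k 2 * (\<Prod>j<r. fact (a j))) = (of_nat (fact (n - 2) * (a k * (a k - 1))) :: complex)"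
      using reduced_multinomial_2[OF that] by simp
    then show ?thesis
      by (cases "a k") (simp_all add: M_def D_def algebra_simps)
  qed
  have "of_nat (card Col * (\<Prod>k<r. fact (a k))) = (of_nat (fact n) :: complex)" unfolding card_Col ..
  then have C: "of_nat (card Col) * D = fact n" by (simp add: D_def)
  have "fact n = (of_nat n * of_nat n - of_nat n) * (fact (n - 2) :: complex)"
  proof -
    obtain m where "n = Suc (Suc m)" using n by (metis add_2_eq_Suc le_Suc_ex)
    then show ?thesis by (simp add: algebra_simps)
  qed
  also have "of_nat n * of_nat n = (\<Sum>k<r. of_nat (a k) * of_nat (a k)) + 2 * E"
    using square_sum_nat[of "\<lambda>k. of_nat (a k)" r] sum_a by (simp add: E_def flip: of_nat_sum)
  also have "of_nat n = (\<Sum>k<r. of_nat (a k) :: complex)" using sum_a by (simp flip: of_nat_sum)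
  finally have n': "fact n = ((\<Sum>k<r. of_nat (a k) * of_nat (a k)) + 2 * E - (\<Sum>k<r. of_nat (a k))) * (fact (n - 2) :: complex)" .
  have "(\<Sum>k<r. M k * D) = fact (n - 2) * ((\<Sum>k<r. of_nat (a k) * of_nat (a k)) - (\<Sum>k<r. of_nat (a k)))"
    unfolding sum_subtractf[symmetric] sum_distrib_left by (intro sum.cong) (simp_all add: M)
  then have "fact n = (\<Sum>k<r. M k * D) + 2 * E * fact (n - 2)"
    unfolding n' by (simp add: algebra_simps)
  then have "(of_nat (card Col) - (\<Sum>k<r. M k)) * D = 2 * E * fact (n - 2)"
    using C by (simp add: left_diff_distrib sum_distrib_right)
  \<comment> \<open>The right side is the number of colourings with different values at two given
    points.\<close>
  then have E: "2 * (fact (n - 2) / D * E) = of_nat (card Col) - (\<Sum>k<r. M k)"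
    using D by (simp add: field_simps)
  have g: "2 * (g_mult (lam ! k) * (\<Prod>j\<in>{..<r} - {k}. of_nat (f_dim (lam ! j))) * M k)
      = P * M k - M k * swap_trace k" if k: "k < r" for k
  proof (cases "a k < 2")
    case True
    then have "M k = 0" using k by (simp add: M_def reduced_multinomial_eq)
    then show ?thesis by simp
  next
    case False
    define Q :: complex where "Q = (\<Prod>j\<in>{..<r} - {k}. of_nat (f_dim (lam ! j)))"
    have P: "P = of_nat (f_dim (lam ! k)) * Q"
      unfolding P_def Q_def using k by (intro prod.remove) auto
    have gm: "2 * g_mult (lam ! k)
        = of_nat (f_dim (lam ! k)) - rep_char (specht (lam ! k)) (Transposition.transpose 1 2)"
      using False by (simp add: g_mult_def part_size_def)
    have "2 * (g_mult (lam ! k) * Q * M k) = (2 * g_mult (lam ! k)) * Q * M k" by simp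
    also have "\<dots> = P * M k - M k * swap_trace k"
      unfolding gm P swap_trace_def Q_def[symmetric] by (simp add: algebra_simps)
    finally show ?thesis unfolding Q_def .
  qed
  have "y_lambda n r lam = P * (fact (n - 2) / D) * E
      + (\<Sum>k<r. g_mult (lam ! k) * (\<Prod>j\<in>{..<r} - {k}. of_nat (f_dim (lam ! j))) * M k)"
    using n by (simp add: y_lambda_def P_def D_def E_def M_def)
  then have "2 * y_lambda n r lam = P * (2 * (fact (n - 2) / D * E))
      + (\<Sum>k<r. 2 * (g_mult (lam ! k) * (\<Prod>j\<in>{..<r} - {k}. of_nat (f_dim (lam ! j))) * M k))"
    by (simp add: distrib_left sum_distrib_left)
  also have "(\<Sum>k<r. 2 * (g_mult (lam ! k) * (\<Prod>j\<in>{..<r} - {k}. of_nat (f_dim (lam ! j))) * M k))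
      = (\<Sum>k<r. P * M k - M k * swap_trace k)"
    by (rule sum.cong) (simp_all only: g lessThan_iff)
  also have "P * (2 * (fact (n - 2) / D * E)) + (\<Sum>k<r. P * M k - M k * swap_trace k)
      = P * of_nat (card Col) - (\<Sum>k<r. M k * swap_trace k)"
    unfolding E by (simp add: sum_subtractf sum_distrib_left[symmetric] algebra_simps)
  finally show ?thesis by (simp add: card_pts P_def M_def mult.commute)
qed

section \<open>From transpositions to the whole group\<close>

lemma det_transpose:
  assumes pq: "p \<in> N" "q \<in> N" "p \<noteq> q"
  shows "\<exists>m. y_lambda n r lam = of_nat m \<and>
    det_on ind.V (ind.act (vec0, Transposition.transpose p q)) = (-1) ^ m"
proof -
  let ?g = "(vec0, Transposition.transpose p q)"
  note \<tau> = permutes_swap_id[OF pq(1,2)]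
  have g: "?g \<in> carrier G" by (rule vec0_carrier[OF \<tau>])
  have "?g \<otimes>\<^bsub>G\<^esub> ?g = \<one>\<^bsub>G\<^esub>" by (simp add: vec0_mult[OF \<tau>] one_eq)
  then have "ind.act ?g (ind.act ?g v) = v" if "v \<in> ind.V" for v
    using ind.act_mult_induced[OF g g, of v] ind.act_one_induced[OF that] by simp
  from det_on_involution[OF ind.lagrange_induced ind.act_linear ind.act_closed[OF g] this]
  obtain m where m: "det_on ind.V (ind.act ?g) = (-1) ^ m"
    "of_nat (card (rep_of ` Col \<times> pts)) - (\<Sum>p\<in>rep_of ` Col \<times> pts. ind.act ?g (ind.ind_fun p) p) = 2 * of_nat m"
    by blast
  have "card {p, q} \<le> card N" using pq by (intro card_mono) auto
  then have "n \<ge> 2" using pq by simp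
  from y_lambda_eq[OF this] have "2 * y_lambda n r lam = 2 * of_nat m"
    using m(2) unfolding trace_transpose[OF pq] card_cartesian_product card_image[OF inj_rep_of] by simp
  then show ?thesis using m(1) by auto
qed

text \<open>One exponent has to serve all transpositions. It does, because each of them produces an
  \<open>m\<close> equal to the same number \<open>y_lambda\<close>; multiplicativity then extends
  the formula to products of transpositions.\<close>

lemma det_permutation:
  "\<exists>m. y_lambda n r lam = of_nat m \<and>
    (\<forall>w. w permutes N \<longrightarrow> det_on ind.V (ind.act (vec0, w)) = of_int (sign w) ^ m)"
proof -
  obtain m where y: "y_lambda n r lam = of_nat m"
    and \<tau>: "\<And>p q. p \<in> N \<Longrightarrow> q \<in> N \<Longrightarrow> p \<noteq> q \<Longrightarrow>
      det_on ind.V (ind.act (vec0, Transposition.transpose p q)) = (-1) ^ m"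
  proof (cases "\<exists>p\<in>N. \<exists>q\<in>N. p \<noteq> q")
    case True
    then obtain m where m: "y_lambda n r lam = of_nat m" using det_transpose by blast
    show ?thesis
    proof (rule that[OF m])
      fix p q assume "p \<in> N" "q \<in> N" "p \<noteq> q"
      from det_transpose[OF this] obtain m' where m': "y_lambda n r lam = of_nat m'"
        "det_on ind.V (ind.act (vec0, Transposition.transpose p q)) = (-1) ^ m'" by blast
      have "m' = m" using m m'(1) by simp
      then show "det_on ind.V (ind.act (vec0, Transposition.transpose p q)) = (-1) ^ m" using m'(2) by simp
    qed
  next
    case False
    have "n < 2"
    proof (rule ccontr)
      assume "\<not> n < 2"
      then have "1 \<in> N" "2 \<in> N" by (simp_all add: N_def)
      then show False using False by (metis numeral_One numeral_eq_iff semiring_norm(85))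
    qed
    \<comment> \<open>With fewer than two points there are no transpositions to determine the
      exponent; the value 0 built into \<open>y_lambda\<close> supplies it.\<close>
    then have "y_lambda n r lam = of_nat 0" by (simp add: y_lambda_def)
    then show ?thesis by (rule that) (use False in blast)
  qed
  have "det_on ind.V (ind.act (vec0, w)) = of_int (sign w) ^ m" if w: "w permutes N" for w
    using w finite_N
  proof (induction w rule: permutes_induct)
    case id
    have "det_on ind.V (ind.act (vec0, id)) = 1"
      by (rule det_on_id[OF ind.lagrange_induced ind.act_linear])
        (use ind.act_one_induced in \<open>simp add: one_eq\<close>)
    then show ?case by (simp only: sign_id of_int_1 power_one)
  next
    case (swap p q w)
    note t = permutes_swap_id[OF swap(1,2)]
    have pw: "permutation w" using swap(4) finite_N permutation_permutes by blast
    have "det_on ind.V (ind.act (vec0, Transposition.transpose p q \<circ> w)) = (-1) ^ m * of_int (sign w) ^ m"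
      unfolding vec0_mult[OF t, symmetric] det_mult[OF vec0_carrier[OF t] vec0_carrier[OF swap(4)]]
      using \<tau>[OF swap(1-3)] swap(5) by simp
    also have "\<dots> = of_int (sign (Transposition.transpose p q \<circ> w)) ^ m"
      using swap(3) pw
      by (subst sign_compose) (auto simp: sign_swap_id permutation_swap_id power_mult_distrib[symmetric])
    finally show ?case .
  qed
  then show ?thesis using y by blast
qed

lemma det_rho:
  "\<exists>y::int. of_int y = y_lambda n r lam \<and>
    (\<forall>g\<in>carrier G.
       rep_det (rho_lambda \<zeta> n r lam) g = zeta_char \<zeta> n g ^ x_lambda n r lam * sgn_char g powi y)"
proof -
  obtain m where y: "y_lambda n r lam = of_nat m"
    and m: "\<And>w. w permutes N \<Longrightarrow> det_on ind.V (ind.act (vec0, w)) = of_int (sign w) ^ m"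
    using det_permutation by blast
  have "rep_det (rho_lambda \<zeta> n r lam) g = zeta_char \<zeta> n g ^ x_lambda n r lam * sgn_char g powi int m"
    if g: "g \<in> carrier G" for g
  proof -
    obtain x w where xw: "g = (x, w)" by (cases g)
    have c: "(x, id) \<in> carrier G" "(vec0, w) \<in> carrier G" "w permutes N"
      using g vec0_carrier by (auto simp: xw carrier_iff permutes_id)
    \<comment> \<open>The translation stands on the left, so that the product law does not permute
      its coordinates.\<close>
    have "g = (x, id) \<otimes>\<^bsub>G\<^esub> (vec0, w)"
      using g by (auto simp: xw mult_eq carrier_iff vec0_def fun_eq_iff PiE_iff extensional_def)
    then have "rep_det (rho_lambda \<zeta> n r lam) g = (\<zeta> powi (\<Sum>i\<in>N. x i)) ^ x_lambda n r lam * of_int (sign w) ^ m"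
      using det_mult[OF c(1,2)] det_translation_eq[OF c(1)] m[OF c(3)] by (simp add: rep_det_rho)
    then show ?thesis by (simp add: xw zeta_char_def sgn_char_def N_def)
  qed
  then show ?thesis using y by (intro exI[of _ "int m"]) simp
qed

end

theorem theorem4:
  fixes n r :: nat and \<zeta> :: complex and lam :: "nat list list"
  assumes "n > 0" and "r > 0"
    and "\<zeta> ^ r = 1" and "\<And>k. 0 < k \<Longrightarrow> k < r \<Longrightarrow> \<zeta> ^ k \<noteq> 1"
    and "lam \<in> multipartitions n r"
  shows "\<exists>y::int. of_int y = y_lambda n r lam \<and>
    (\<forall>g\<in>carrier (wreath_group n r).
       rep_det (rho_lambda \<zeta> n r lam) g = zeta_char \<zeta> n g ^ x_lambda n r lam * sgn_char g powi y)"
  by (rule wreath_rep.det_rho) (unfold_locales, fact+)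

end
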